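(* There is an absolute constant $C$ such that the problem $$\max\{\mathbf c^\top\mathbf x:\ \mathbf x\in\mathbb Z_{\ge0}^n,\ \lVert\mathbf x\rVert^2\le r^2\},$$ with $\mathbf c\in\mathbb Z_{>0}^n$, $c_1\ge\cdots\ge c_n$, and $r^2\in\mathbb Z_{\ge0}$, can be solved exactly in $$\bigl(C(1+\sqrt r\,n^{1/4})\bigr)^{n-1}\operatorname{poly}(L)$$ time, where $r=\sqrt{r^2}$ and $L=\langle\mathbf c,r^2\rangle$.
   Context: $\lVert\cdot\rVert$ is the Euclidean norm. $\langle\mathbf c,r^2\rangle$ is the total binary encoding length of the input $(\mathbf c,r^2)$, and $\operatorname{poly}(L)$ denotes an unspecified polynomial factor. Time is bit complexity. *)

theory Defs
  imports
    "HOL-Analysis.Analysis"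
    "HOL-Computational_Algebra.Polynomial"
    "HOL-Library.Log_Nat"
begin

section \<open>The optimisation problem\<close>

text \<open>Vectors of $\mathbb{Z}_{\ge 0}^n$ are lists of naturals of length $n$, since $n$ is part of
  the input of the algorithm.\<close>

definition eucl_norm :: "nat list \<Rightarrow> real"
  where "eucl_norm x = L2_set (\<lambda>i. real (x ! i)) {..<length x}"

definition objective :: "nat list \<Rightarrow> nat list \<Rightarrow> nat"
  where "objective c x = (\<Sum>i<length c. c ! i * x ! i)"

definition feasible :: "nat \<Rightarrow> nat \<Rightarrow> nat list \<Rightarrow> bool"
  where "feasible n R x \<longleftrightarrow> length x = n \<and> (eucl_norm x)\<^sup>2 \<le> real R"

definition optimal :: "nat list \<Rightarrow> nat \<Rightarrow> nat list \<Rightarrow> bool"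
  where "optimal c R x \<longleftrightarrow> is_arg_max (objective c) (feasible (length c) R) x"

section \<open>Binary encoding length\<close>

text \<open>One sign bit plus the binary digits of the absolute value; in particular it is positive.\<close>

definition enc_len :: "int \<Rightarrow> nat"
  where "enc_len z = 1 + floorlog 2 (nat \<bar>z\<bar>)"

definition input_len :: "nat list \<Rightarrow> nat \<Rightarrow> nat"
  where "input_len c R = (\<Sum>i<length c. enc_len (int (c ! i))) + enc_len (int R)"

section \<open>Random access machine with bit costs\<close>

text \<open>
  Structured programs for a random access machine whose cells, addressed by integers, hold
  integers of arbitrary size (\<open>Cell e\<close> is the cell whose address is the value of \<open>e\<close>, so
  indirect addressing is included).  Running time is charged at the logarithmic (bit) cost: an
  access costs the lengths of the address and of the contents, an addition or subtraction the
  lengths of both operands, and a multiplication or division the product of these lengths, as for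
  the schoolbook algorithms.
\<close>

datatype expr =
    Lit int
  | Cell expr
  | Add expr expr
  | Sub expr expr
  | Mul expr expr
  | Div expr expr

datatype prog =
    Skip
  | Store expr expr  \<comment> \<open>address, value\<close>
  | Seq prog prog
  | Cond expr prog prog
  | While expr prog

type_synonym memory = "int \<Rightarrow> int"

primrec val :: "expr \<Rightarrow> memory \<Rightarrow> int" where
  "val (Lit k) m = k"
| "val (Cell e) m = m (val e m)"
| "val (Add e f) m = val e m + val f m"
| "val (Sub e f) m = val e m - val f m"
| "val (Mul e f) m = val e m * val f m"
| "val (Div e f) m = val e m div val f m"

primrec cost :: "expr \<Rightarrow> memory \<Rightarrow> nat" where
  "cost (Lit k) m = enc_len k"
| "cost (Cell e) m = cost e m + enc_len (val e m) + enc_len (m (val e m))"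
| "cost (Add e f) m = cost e m + cost f m + (enc_len (val e m) + enc_len (val f m))"
| "cost (Sub e f) m = cost e m + cost f m + (enc_len (val e m) + enc_len (val f m))"
| "cost (Mul e f) m = cost e m + cost f m + enc_len (val e m) * enc_len (val f m)"
| "cost (Div e f) m = cost e m + cost f m + enc_len (val e m) * enc_len (val f m)"

text \<open>\<open>exec p m t m'\<close>: started in memory \<open>m\<close>, program \<open>p\<close> halts after time \<open>t\<close> in memory \<open>m'\<close>.
  A test succeeds iff the value of its expression is positive.\<close>

inductive exec :: "prog \<Rightarrow> memory \<Rightarrow> nat \<Rightarrow> memory \<Rightarrow> bool" where
  Skip: "exec Skip m 1 m"
| Store: "exec (Store e f) m
    (cost e m + cost f m + enc_len (val e m) + enc_len (val f m))
    (m(val e m := val f m))"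
| Seq: "exec p m t m' \<Longrightarrow> exec q m' u m'' \<Longrightarrow> exec (Seq p q) m (t + u) m''"
| CondTrue: "val e m > 0 \<Longrightarrow> exec p m t m' \<Longrightarrow> exec (Cond e p q) m (1 + cost e m + t) m'"
| CondFalse: "val e m \<le> 0 \<Longrightarrow> exec q m t m' \<Longrightarrow> exec (Cond e p q) m (1 + cost e m + t) m'"
| WhileTrue: "val e m > 0 \<Longrightarrow> exec p m t m' \<Longrightarrow> exec (While e p) m' u m'' \<Longrightarrow>
    exec (While e p) m (1 + cost e m + t + u) m''"
| WhileFalse: "val e m \<le> 0 \<Longrightarrow> exec (While e p) m (1 + cost e m) m"

text \<open>Since programs are deterministic, the existence of a terminating execution describes the
  only possible behaviour.\<close>

inductive_cases SkipE: "exec Skip m t m'"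
inductive_cases StoreE: "exec (Store e f) m t m'"
inductive_cases SeqE: "exec (Seq p q) m t m'"
inductive_cases CondE: "exec (Cond e p q) m t m'"
inductive_cases WhileE: "exec (While e p) m t m'"

lemma exec_deterministic:
  assumes "exec p m t m'" and "exec p m u m''"
  shows "t = u \<and> m' = m''"
  using assms
proof (induction arbitrary: u m'' rule: exec.induct)
  case (Skip m)
  then show ?case by (auto elim: SkipE)
next
  case (Store e f m)
  then show ?case by (auto elim: StoreE)
next
  case (Seq p m t m1 q u m2 v m3)
  from Seq.prems obtain t' u' m' where "exec p m t' m'" "exec q m' u' m3" "v = t' + u'"
    by (rule SeqE)
  with Seq.IH(1)[of t' m'] Seq.IH(2)[of u' m3] show ?case by simp
next
  case (CondTrue e m p t m1 q v m2)
  from CondTrue.prems CondTrue.hyps(1) obtain t' where "exec p m t' m2" "v = 1 + cost e m + t'"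
    by (auto elim!: CondE)
  with CondTrue.IH[of t' m2] show ?case by simp
next
  case (CondFalse e m q t m1 p v m2)
  from CondFalse.prems CondFalse.hyps(1) obtain t' where "exec q m t' m2" "v = 1 + cost e m + t'"
    by (auto elim!: CondE)
  with CondFalse.IH[of t' m2] show ?case by simp
next
  case (WhileTrue e m p t m1 u m2 v m3)
  from WhileTrue.prems WhileTrue.hyps(1) obtain t' u' m' where
    "exec p m t' m'" "exec (While e p) m' u' m3" "v = 1 + cost e m + t' + u'"
    by (cases rule: WhileE) auto
  with WhileTrue.IH(1)[of t' m'] WhileTrue.IH(2)[of u' m3] show ?case by simp
next
  case (WhileFalse e m p v m3)
  from WhileFalse.prems show ?case
  proof (rule WhileE)
    fix t m' u
    assume "0 < val e m"
    with WhileFalse.hyps show ?thesis by linarith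
  qed simp
qed

section \<open>Solving the problem\<close>

text \<open>The input occupies the cells from \<open>0\<close> on as \<open>n, r\<^sup>2, c\<^sub>1, \<dots>, c\<^sub>n\<close>; all other cells are \<open>0\<close>.\<close>

definition input_mem :: "nat list \<Rightarrow> nat \<Rightarrow> memory"
  where "input_mem c R = (\<lambda>a. let xs = length c # R # c in
    if 0 \<le> a \<and> a < int (length xs) then int (xs ! nat a) else 0)"

text \<open>The output is the optimal value in cell \<open>0\<close> and an optimal solution
  \<open>x\<^sub>1, \<dots>, x\<^sub>n\<close> in the cells \<open>1, \<dots>, n\<close>.\<close>

definition holds_optimum :: "nat list \<Rightarrow> nat \<Rightarrow> memory \<Rightarrow> bool"
  where "holds_optimum c R m \<longleftrightarrow> (\<exists>x. optimal c R x \<and>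
    m 0 = int (objective c x) \<and> (\<forall>i<length c. m (int i + 1) = int (x ! i)))"

definition solves_within :: "prog \<Rightarrow> nat list \<Rightarrow> nat \<Rightarrow> real \<Rightarrow> bool"
  where "solves_within p c R T \<longleftrightarrow>
    (\<exists>t m. exec p (input_mem c R) t m \<and> holds_optimum c R m \<and> real t \<le> T)"

end

theory Submission
  imports Defs "HOL-Library.Discrete_Functions"
begin

text \<open>
  Let $S = \lVert c\rVert^2$ and $y = r c / \lVert c\rVert$. Rounding $y$ down gives a feasible point
  of value at least $r\lVert c\rVert - \sqrt n\,\lVert c\rVert$, so an optimal $x$ lies in a thin cap of
  the ball and satisfies $\lVert x - y\rVert^2 \le 2 r \sqrt n$. Hence each coordinate of $x$ is within
  $D = O(1 + \sqrt r\, n^{1/4})$ of $\lfloor y_i\rfloor$. The program enumerates the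
  $(2D+1)^{n-1}$ choices for all coordinates but one, encoded as the base-$(2D+1)$ digits of a
  counter, and gives the remaining coordinate the largest value that the ball permits. All numbers
  that occur have $O(L^2)$ bits.
\<close>

section \<open>Running times up to a common factor\<close>

text \<open>The cap estimate expands ||x - y||^2 = ||x||^2 - 2<x,y> + r^2 with ||x|| <= r and <x,y>
  >= r(r - sqrt n). The rounding loss sqrt n * ||c|| is Cauchy-Schwarz for the sum of the c_i. The
  exponent is n - 1 because, once the other coordinates are fixed, the objective grows with the
  remaining one, so only its largest admissible value matters. The machine has only integers, while
  y is irrational in general. The centres floor(y_i) and the radius D are therefore expressed
  through integer square roots of integers, which bisection finds in a number of rounds linear in
  the bit length. Bit costs are the other obstacle. If all cells stay within 2^b in absolute value,
  one evaluation of a fixed expression costs a constant times b^2. Time then reduces to counting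
  loop rounds, and the size bounds are checked assignment by assignment. The work per candidate is
  polynomial in L, so only the number of candidates enters the exponential factor.\<close>

definition bnd :: "nat \<Rightarrow> memory \<Rightarrow> bool"
  where "bnd b m \<longleftrightarrow> (\<forall>a. \<bar>m a\<bar> \<le> 2 ^ b)"

text \<open>The exponent, in units of \<open>b\<close>, that bounds a value over a memory bounded by
  \<open>2 ^ b\<close>. A cell counts 1 whatever its address, since the bound covers all cells; a
  quotient counts like its dividend.\<close>

primrec deg :: "expr \<Rightarrow> nat" where
  "deg (Lit k) = enc_len k"
| "deg (Cell e) = 1"
| "deg (Add e f) = deg e + deg f + 1"
| "deg (Sub e f) = deg e + deg f + 1"
| "deg (Mul e f) = deg e + deg f"
| "deg (Div e f) = deg e"

text \<open>The factors \<open>deg e + 2\<close> bound bit lengths in units of \<open>b\<close>, and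
  the 3 for a cell is its own degree plus 2. The sum bounds the cost in units of
  \<open>b\<^sup>2\<close>, the order of the schoolbook products.\<close>

primrec expr_weight :: "expr \<Rightarrow> nat" where
  "expr_weight (Lit k) = enc_len k"
| "expr_weight (Cell e) = expr_weight e + (deg e + 2) + 3"
| "expr_weight (Add e f) = expr_weight e + expr_weight f + (deg e + 2) + (deg f + 2)"
| "expr_weight (Sub e f) = expr_weight e + expr_weight f + (deg e + 2) + (deg f + 2)"
| "expr_weight (Mul e f) = expr_weight e + expr_weight f + (deg e + 2) * (deg f + 2)"
| "expr_weight (Div e f) = expr_weight e + expr_weight f + (deg e + 2) * (deg f + 2)"

primrec prog_weight :: "prog \<Rightarrow> nat" where
  "prog_weight Skip = 1"
| "prog_weight (Store e f) = expr_weight e + expr_weight f + (deg e + 2) + (deg f + 2)"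
| "prog_weight (Seq p q) = prog_weight p + prog_weight q"
| "prog_weight (Cond e p q) = 1 + expr_weight e + prog_weight p + prog_weight q"
| "prog_weight (While e p) = 1 + expr_weight e + prog_weight p"

lemma enc_len_le:
  assumes "\<bar>z\<bar> \<le> 2 ^ e"
  shows "enc_len z \<le> e + 2"
proof -
  have "nat \<bar>z\<bar> \<le> 2 ^ e"
    using assms by (simp add: nat_le_iff)
  also have "\<dots> < 2 ^ (e + 1)"
    by simp
  finally have "nat \<bar>z\<bar> < 2 ^ (e + 1)" .
  then have "floorlog 2 (nat \<bar>z\<bar>) \<le> e + 1"
    by (simp add: floorlog_le_iff)
  then show ?thesis
    by (simp add: enc_len_def)
qed

lemma abs_less_two_power_enc_len: "\<bar>z\<bar> < 2 ^ enc_len z"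
proof -
  have "nat \<bar>z\<bar> < 2 ^ (floorlog 2 (nat \<bar>z\<bar>))"
    using floorlog_bounds[of "nat \<bar>z\<bar>" 2] by (cases "z = 0") (auto simp: floorlog_def)
  also have "\<dots> \<le> 2 ^ enc_len z"
    by (simp add: enc_len_def)
  finally have "int (nat \<bar>z\<bar>) < int (2 ^ enc_len z)"
    by (simp only: of_nat_less_iff)
  then show ?thesis
    by simp
qed

text \<open>Division rounds towards minus infinity, so a negative quotient moves away from 0, but
  never beyond the quotient by 1. A negative divisor is reduced to a positive one by negating both
  arguments, and division by 0 yields 0.\<close>

lemma abs_div_le: "\<bar>x div y\<bar> \<le> \<bar>x::int\<bar>"
proof -
  have *: "\<bar>u div v\<bar> \<le> \<bar>u\<bar>" if "v > 0" for u v :: int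
  proof (cases "u \<ge> 0")
    case True
    then show ?thesis
      using that zdiv_mono2[of u 1 v] by (simp add: pos_imp_zdiv_nonneg_iff)
  next
    case False
    then show ?thesis
      using that zdiv_mono2_neg[of u 1 v] div_neg_pos_less0[of u v] by simp
  qed
  show ?thesis
  proof (cases y "0::int" rule: linorder_cases)
    case less
    then show ?thesis
      using *[of "- y" "- x"] by simp
  qed (use * in auto)
qed

lemma abs_val_le:
  assumes "bnd b m" and "b \<ge> 1"
  shows "\<bar>val e m\<bar> \<le> 2 ^ (deg e * b)"
proof (induction e)
  case (Lit k)
  have "\<bar>k\<bar> \<le> 2 ^ enc_len k"
    using abs_less_two_power_enc_len[of k] by simp
  also have "(2::int) ^ enc_len k \<le> 2 ^ (enc_len k * b)"
    using assms(2) by (intro power_increasing) auto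
  finally show ?case
    by simp
next
  case (Cell e)
  then show ?case
    using assms(1) by (simp add: bnd_def)
next
  case (Add e f)
  have "(2::int) ^ (deg e * b) \<le> 2 ^ (deg e * b + deg f * b)"
       "(2::int) ^ (deg f * b) \<le> 2 ^ (deg e * b + deg f * b)"
    by (intro power_increasing; simp)+
  then have "\<bar>val e m + val f m\<bar> \<le> 2 ^ (deg e * b + deg f * b + 1)"
    using Add unfolding power_add power_one_right by linarith
  also have "\<dots> \<le> 2 ^ (deg (Add e f) * b)"
    using assms(2) by (intro power_increasing) (auto simp: algebra_simps)
  finally show ?case
    by simp
next
  case (Sub e f)
  have "(2::int) ^ (deg e * b) \<le> 2 ^ (deg e * b + deg f * b)"
       "(2::int) ^ (deg f * b) \<le> 2 ^ (deg e * b + deg f * b)"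
    by (intro power_increasing; simp)+
  then have "\<bar>val e m - val f m\<bar> \<le> 2 ^ (deg e * b + deg f * b + 1)"
    using Sub unfolding power_add power_one_right by linarith
  also have "\<dots> \<le> 2 ^ (deg (Sub e f) * b)"
    using assms(2) by (intro power_increasing) (auto simp: algebra_simps)
  finally show ?case
    by simp
next
  case (Mul e f)
  then show ?case
    by (simp add: abs_mult power_add add_mult_distrib mult_mono)
next
  case (Div e f)
  have "\<bar>val e m div val f m\<bar> \<le> \<bar>val e m\<bar>"
    by (rule abs_div_le)
  then show ?case
    using Div(1) by simp
qed

lemma enc_len_val_le:
  assumes "bnd b m" and "b \<ge> 1"
  shows "enc_len (val e m) \<le> (deg e + 2) * b"
proof -
  have "enc_len (val e m) \<le> deg e * b + 2"
    by (rule enc_len_le[OF abs_val_le[OF assms]])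
  with assms(2) show ?thesis
    by (simp add: algebra_simps)
qed

lemma le_mult_square: "x \<le> w * b \<Longrightarrow> x \<le> w * b\<^sup>2" for b :: nat
  by (cases b) (auto simp: power2_eq_square intro: order_trans)

lemma cost_le:
  assumes "bnd b m" and "b \<ge> 1"
  shows "cost e m \<le> expr_weight e * b\<^sup>2"
proof (induction e)
  case (Lit k)
  then show ?case
    using assms(2) by simp
next
  case (Cell e)
  have "enc_len (m (val e m)) \<le> 3 * b"
    using enc_len_val_le[OF assms, of "Cell e"] by simp
  from Cell le_mult_square[OF this] le_mult_square[OF enc_len_val_le[OF assms, of e]]
  show ?case
    by (simp add: algebra_simps)
next
  case (Add e f)
  from Add le_mult_square[OF enc_len_val_le[OF assms, of e]]
    le_mult_square[OF enc_len_val_le[OF assms, of f]]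
  show ?case
    by (simp add: algebra_simps)
next
  case (Sub e f)
  from Sub le_mult_square[OF enc_len_val_le[OF assms, of e]]
    le_mult_square[OF enc_len_val_le[OF assms, of f]]
  show ?case
    by (simp add: algebra_simps)
next
  case (Mul e f)
  have "enc_len (val e m) * enc_len (val f m) \<le> (deg e + 2) * b * ((deg f + 2) * b)"
    by (intro mult_mono enc_len_val_le assms) auto
  with Mul show ?case
    by (simp add: algebra_simps power2_eq_square)
next
  case (Div e f)
  have "enc_len (val e m) * enc_len (val f m) \<le> (deg e + 2) * b * ((deg f + 2) * b)"
    by (intro mult_mono enc_len_val_le assms) auto
  with Div show ?case
    by (simp add: algebra_simps power2_eq_square)
qed

text \<open>The number \<open>s\<close> bounds the time in units of \<open>prog_weight p * b\<^sup>2\<close>. As weights add up under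
  \<open>Seq\<close>, the same \<open>s\<close> serves a program and its parts, and only loops multiply it.\<close>

definition runs :: "nat \<Rightarrow> prog \<Rightarrow> memory \<Rightarrow> nat \<Rightarrow> (memory \<Rightarrow> bool) \<Rightarrow> bool"
  where "runs b p m s Q \<longleftrightarrow> (bnd b m \<longrightarrow>
    (\<exists>t m'. exec p m t m' \<and> t \<le> s * (prog_weight p * b\<^sup>2) \<and> bnd b m' \<and> Q m'))"

lemma runs_mono:
  assumes "runs b p m s Q" and "s \<le> s'" and "\<And>m'. Q m' \<Longrightarrow> Q' m'"
  shows "runs b p m s' Q'"
  using assms mult_le_mono1[OF assms(2), of "prog_weight p * b\<^sup>2"] unfolding runs_def
  by (meson order_trans)

lemma runs_Skip: "1 \<le> s \<Longrightarrow> 1 \<le> b \<Longrightarrow> Q m \<Longrightarrow> runs b Skip m s Q"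
  unfolding runs_def using exec.Skip[of m] by (fastforce simp: Suc_le_eq)

lemma runs_Store:
  assumes "1 \<le> s" and "1 \<le> b" and "\<bar>val f m\<bar> \<le> 2 ^ b" and "Q (m(val e m := val f m))"
  shows "runs b (Store e f) m s Q"
  unfolding runs_def
proof
  assume m: "bnd b m"
  have "cost e m + cost f m + enc_len (val e m) + enc_len (val f m)
      \<le> 1 * (prog_weight (Store e f) * b\<^sup>2)"
    using cost_le[OF m assms(2), of e] cost_le[OF m assms(2), of f]
      le_mult_square[OF enc_len_val_le[OF m assms(2), of e]]
      le_mult_square[OF enc_len_val_le[OF m assms(2), of f]]
    by (simp add: algebra_simps)
  also have "\<dots> \<le> s * (prog_weight (Store e f) * b\<^sup>2)"
    using assms(1) by (rule mult_le_mono1)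
  finally show "\<exists>t m'. exec (Store e f) m t m' \<and> t \<le> s * (prog_weight (Store e f) * b\<^sup>2)
      \<and> bnd b m' \<and> Q m'"
    using exec.Store[of e f m] assms(3,4) m by (fastforce simp: bnd_def)
qed

text \<open>Nesting the second statement in the postcondition of the first gives a
  weakest-precondition calculus: a program is executed symbolically from left to right, and the
  bound on the intermediate memory is carried along inside \<open>runs\<close>.\<close>

lemma runs_Seq:
  assumes "runs b p m s (\<lambda>m'. runs b q m' s Q)"
  shows "runs b (Seq p q) m s Q"
  unfolding runs_def
proof
  assume "bnd b m"
  with assms obtain t m' u m'' where "exec p m t m'" "t \<le> s * (prog_weight p * b\<^sup>2)"
    and "exec q m' u m''" "u \<le> s * (prog_weight q * b\<^sup>2)" "bnd b m''" "Q m''"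
    unfolding runs_def by blast
  then show "\<exists>t m'. exec (Seq p q) m t m' \<and> t \<le> s * (prog_weight (Seq p q) * b\<^sup>2)
      \<and> bnd b m' \<and> Q m'"
    by (intro exI[of _ "t + u"] exI[of _ m'']) (auto simp: algebra_simps intro: exec.Seq)
qed

lemma test_cost_le:
  assumes "bnd b m" and "1 \<le> b" and "1 \<le> s"
  shows "1 + cost e m \<le> s * ((1 + expr_weight e) * b\<^sup>2)"
proof -
  have "1 + cost e m \<le> 1 * ((1 + expr_weight e) * b\<^sup>2)"
    using cost_le[OF assms(1,2), of e] one_le_power[OF assms(2), of 2]
    by (simp add: add_mult_distrib)
  also have "\<dots> \<le> s * ((1 + expr_weight e) * b\<^sup>2)"
    using assms(3) by (rule mult_le_mono1)
  finally show ?thesis .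
qed

lemma runs_Cond:
  assumes s: "1 \<le> s" and b: "1 \<le> b"
    and p: "0 < val e m \<Longrightarrow> runs b p m s Q" and q: "val e m \<le> 0 \<Longrightarrow> runs b q m s Q"
  shows "runs b (Cond e p q) m s Q"
  unfolding runs_def
proof
  assume m: "bnd b m"
  note test = test_cost_le[OF m b s, of e]
  show "\<exists>t m'. exec (Cond e p q) m t m' \<and> t \<le> s * (prog_weight (Cond e p q) * b\<^sup>2)
      \<and> bnd b m' \<and> Q m'"
  proof (cases "0 < val e m")
    case True
    with p m obtain t m' where "exec p m t m'" "t \<le> s * (prog_weight p * b\<^sup>2)" "bnd b m'" "Q m'"
      unfolding runs_def by blast
    with True test show ?thesis
      by (intro exI[of _ "1 + cost e m + t"] exI[of _ m'])
        (use exec.CondTrue[of e m p t m' q] in \<open>auto simp: algebra_simps\<close>)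
  next
    case False
    with q m obtain t m' where "exec q m t m'" "t \<le> s * (prog_weight q * b\<^sup>2)" "bnd b m'" "Q m'"
      unfolding runs_def by (meson not_less)
    with False test show ?thesis
      by (intro exI[of _ "1 + cost e m + t"] exI[of _ m'])
        (use exec.CondFalse[of e m q t m' p] in \<open>auto simp: algebra_simps\<close>)
  qed
qed

text \<open>The index of the invariant is a variant that bounds the rounds still to come. The factor
  \<open>k + 1\<close> leaves one more unit for the final failing test.\<close>

lemma runs_While:
  assumes s: "1 \<le> s" and b: "1 \<le> b"
    and step: "\<And>k m. I k m \<Longrightarrow> 0 < val e m \<Longrightarrow> runs b p m s (\<lambda>m'. \<exists>j<k. I j m')"
    and exit: "\<And>k m. I k m \<Longrightarrow> val e m \<le> 0 \<Longrightarrow> Q m"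
    and init: "I k m" and s': "(k + 1) * s \<le> s'"
  shows "runs b (While e p) m s' Q"
proof -
  have "runs b (While e p) m ((k + 1) * s) Q"
    using init
  proof (induction k arbitrary: m rule: less_induct)
    case (less k)
    show ?case
      unfolding runs_def
    proof
      assume m: "bnd b m"
      note test = test_cost_le[OF m b s, of e]
      show "\<exists>t m'. exec (While e p) m t m' \<and> t \<le> (k + 1) * s * (prog_weight (While e p) * b\<^sup>2)
          \<and> bnd b m' \<and> Q m'"
      proof (cases "0 < val e m")
        case True
        with step[OF less.prems] m obtain t m' j where t: "exec p m t m'"
            "t \<le> s * (prog_weight p * b\<^sup>2)" and m': "bnd b m'" and j: "j < k" "I j m'"
          unfolding runs_def by blast
        from less.IH[OF j] m' obtain u m'' where u: "exec (While e p) m' u m''"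
            "u \<le> (j + 1) * s * (prog_weight (While e p) * b\<^sup>2)" and "bnd b m''" "Q m''"
          unfolding runs_def by blast
        have "u \<le> (j + 1) * (s * (prog_weight (While e p) * b\<^sup>2))"
          using u(2) by (simp only: mult.assoc)
        also have "\<dots> \<le> k * (s * (prog_weight (While e p) * b\<^sup>2))"
          using j(1) by (intro mult_le_mono1) simp
        finally have "u \<le> k * (s * (prog_weight (While e p) * b\<^sup>2))" .
        moreover have "1 + cost e m + t \<le> s * (prog_weight (While e p) * b\<^sup>2)"
          using test t(2) by (simp add: algebra_simps)
        ultimately have "1 + cost e m + t + u \<le> (k + 1) * s * (prog_weight (While e p) * b\<^sup>2)"
          by (simp add: add_mult_distrib mult.assoc)
        with True t(1) u(1) \<open>bnd b m''\<close> \<open>Q m''\<close> show ?thesis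
          by (blast intro: exec.WhileTrue)
      next
        case False
        have "1 + cost e m \<le> s * (prog_weight (While e p) * b\<^sup>2)"
          using test by (simp add: algebra_simps)
        also have "\<dots> \<le> (k + 1) * s * (prog_weight (While e p) * b\<^sup>2)"
          by simp
        finally show ?thesis
          using False exec.WhileFalse[of e m p] exit[OF less.prems] m by (metis not_less)
      qed
    qed
  qed
  then show ?thesis
    using s' by (rule runs_mono)
qed

section \<open>The program\<close>

abbreviation (input) V :: "int \<Rightarrow> expr" where "V a \<equiv> Cell (Lit a)"
abbreviation (input) Set :: "int \<Rightarrow> expr \<Rightarrow> prog" where "Set a e \<equiv> Store (Lit a) e"

text \<open>Working storage has negative addresses, and \<open>candidate_prog\<close> leaves the cells from \<open>-20\<close>
  downwards unchanged. It stores coordinate \<open>i\<close> of its candidate at the address \<open>i\<close> plus the contents of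
  \<open>aW\<close>, which is \<open>n + 1\<close> during the search, so that the input survives, and \<open>1\<close> for the output.\<close>

abbreviation (input) aI :: int where "aI \<equiv> -1"
abbreviation (input) aT :: int where "aT \<equiv> -2"
abbreviation (input) aRem :: int where "aRem \<equiv> -3"
abbreviation (input) aVal :: int where "aVal \<equiv> -4"
abbreviation (input) aLo :: int where "aLo \<equiv> -5"
abbreviation (input) aHi :: int where "aHi \<equiv> -6"
abbreviation (input) aArg :: int where "aArg \<equiv> -7"
abbreviation (input) aX :: int where "aX \<equiv> -8"
abbreviation (input) aC0 :: int where "aC0 \<equiv> -20"
abbreviation (input) aS :: int where "aS \<equiv> -21"
abbreviation (input) aD :: int where "aD \<equiv> -22"
abbreviation (input) aB :: int where "aB \<equiv> -23"
abbreviation (input) aBest :: int where "aBest \<equiv> -24"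
abbreviation (input) aArgBest :: int where "aArgBest \<equiv> -25"
abbreviation (input) aW :: int where "aW \<equiv> -26"
abbreviation (input) aK :: int where "aK \<equiv> -27"

text \<open>Bisection between 0 and v + 1. Tests ask for strict positivity, so v + 1 - mid^2 encodes
  mid^2 <= v. For negative v the loop never starts and the answer is 0, which matches
  \<open>floor_sqrt (nat v)\<close>; this case occurs for candidates outside the ball.\<close>

definition floor_sqrt_prog :: prog where
  "floor_sqrt_prog =
    Seq (Set aLo (Lit 0)) (Seq (Set aHi (Add (V aArg) (Lit 1)))
    (While (Sub (Sub (V aHi) (V aLo)) (Lit 1))
      (let mid = Div (Add (V aLo) (V aHi)) (Lit 2) in
        Cond (Sub (Add (V aArg) (Lit 1)) (Mul mid mid)) (Set aLo mid) (Set aHi mid))))"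

text \<open>The machine has no remainder operation, so the lowest digit of the counter is obtained
  as T - (T div B) * B. A centre within distance D of 0 can give a negative coordinate, hence the
  clipping.\<close>

definition step_prog :: prog where
  "step_prog = (let ci = Cell (Add (V aI) (Lit 2)) in
    Seq (Set aArg (Div (Mul (V 1) (Mul ci ci)) (V aS)))
    (Seq floor_sqrt_prog
    (Seq (Set aX (Add (Sub (V aLo) (V aD)) (Sub (V aT) (Mul (Div (V aT) (V aB)) (V aB)))))
    (Seq (Cond (V aX) Skip (Set aX (Lit 0)))
    (Seq (Set aT (Div (V aT) (V aB)))
    (Seq (Set aRem (Sub (V aRem) (Mul (V aX) (V aX))))
    (Seq (Set aVal (Add (V aVal) (Mul ci (V aX))))
    (Seq (Store (Add (V aW) (V aI)) (V aX))
      (Set aI (Add (V aI) (Lit 1)))))))))))"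

text \<open>A candidate that leaves the ball receives the value -1, below every objective value, so
  the search needs no separate feasibility flag.\<close>

definition candidate_prog :: prog where
  "candidate_prog =
    Seq (Set aT (V aK)) (Seq (Set aRem (V 1)) (Seq (Set aVal (Lit 0)) (Seq (Set aI (Lit 1))
    (Seq (While (Sub (V 0) (V aI)) step_prog)
    (Seq (Set aArg (V aRem))
    (Seq floor_sqrt_prog
      (Cond (Add (V aRem) (Lit 1)) (Set aVal (Add (V aVal) (Mul (V aC0) (V aLo))))
        (Set aVal (Lit (-1))))))))))"

definition setup_prog :: prog where
  "setup_prog =
    Seq (Set aC0 (V 2)) (Seq (Set aS (Mul (V 2) (V 2)))
    (Seq (Set aArg (Mul (Lit 4) (Mul (V 1) (V 0)))) (Seq floor_sqrt_prog
    (Seq (Set aArg (V aLo)) (Seq floor_sqrt_prog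
    (Seq (Set aD (Add (V aLo) (Lit 1)))
    (Seq (Set aB (Add (Mul (Lit 2) (V aD)) (Lit 1)))
    (Seq (Set aBest (Lit (-1))) (Seq (Set aArgBest (Lit 0))
    (Seq (Set aW (Add (V 0) (Lit 1))) (Seq (Set aK (Lit 1)) (Seq (Set aI (Lit 1))
      (While (Sub (V 0) (V aI))
        (let ci = Cell (Add (V aI) (Lit 2)) in
          Seq (Set aS (Add (V aS) (Mul ci ci)))
          (Seq (Set aK (Mul (V aK) (V aB)))
            (Set aI (Add (V aI) (Lit 1))))))))))))))))))"

definition search_prog :: prog where
  "search_prog =
    While (V aK)
      (Seq (Set aK (Sub (V aK) (Lit 1)))
      (Seq candidate_prog
        (Cond (Sub (V aVal) (V aBest))
          (Seq (Set aBest (V aVal)) (Set aArgBest (V aK))) Skip)))"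

text \<open>The search keeps only the best counter, so its candidate is generated again, now over
  the input. Coordinate i goes to cell i + 1 while its coefficient sits in cell i + 2, so writing
  stays one cell behind reading. The first coefficient is overwritten at once, which is why
  \<open>setup_prog\<close> saves it in \<open>aC0\<close>; cells 0 and 1 are needed to the end and
  are written last.\<close>

definition output_prog :: prog where
  "output_prog =
    Seq (Set aK (V aArgBest)) (Seq (Set aW (Lit 1)) (Seq candidate_prog
      (Seq (Set 1 (V aLo)) (Set 0 (V aVal)))))"

definition box_search_prog :: prog where
  "box_search_prog = Seq setup_prog (Seq search_prog output_prog)"

lemma runs_floor_sqrt:
  assumes b: "1 \<le> b" and s: "b + 1 \<le> s" and v: "\<bar>m aArg\<bar> < 2 ^ b"
    and Q: "\<And>h. Q (m(aLo := int (floor_sqrt (nat (m aArg))), aHi := h))"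
  shows "runs b floor_sqrt_prog m s Q"
proof -
  define v where "v = m aArg"
  \<comment> \<open>The gap between the bounds is at most \<open>2 ^ k\<close> and halves in each
    round, so \<open>b\<close> rounds suffice. The second branch describes a negative
    argument.\<close>
  define I where "I k m' \<longleftrightarrow> (\<exists>l h. m' = m(aLo := l, aHi := h) \<and> 0 \<le> l \<and> h \<le> 2 ^ b \<and> h - l \<le> 2 ^ k \<and>
    (if 0 \<le> v then l\<^sup>2 \<le> v \<and> v < h\<^sup>2 \<and> l < h else l = 0 \<and> h \<le> 0))" for k m'
  have s1: "1 \<le> s"
    using s by simp
  show ?thesis
    unfolding floor_sqrt_prog_def Let_def
  proof (intro runs_Seq runs_Store[OF s1 b] runs_While[where I = I, OF order_refl b])
    fix k m'
    assume I: "I k m'" and "0 < val (Sub (Sub (V aHi) (V aLo)) (Lit 1)) m'"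
    then obtain l h where m': "m' = m(aLo := l, aHi := h)" and l: "0 \<le> l" and h: "h \<le> 2 ^ b"
      and k: "h - l \<le> 2 ^ k" and lh: "l + 1 < h" "l\<^sup>2 \<le> v" "v < h\<^sup>2" and v0: "0 \<le> v"
      unfolding I_def by (auto split: if_splits)
    from k lh have "k \<noteq> 0"
      by (intro notI) simp
    then obtain j where j: "k = Suc j"
      by (cases k) auto
    define mid where "mid = (l + h) div 2"
    have mid: "l < mid" "mid < h" "h - mid \<le> 2 ^ j" "mid - l \<le> 2 ^ j"
      using k lh(1) unfolding mid_def j by auto
    show "runs b (Cond (Sub (Add (V aArg) (Lit 1))
        (Mul (Div (Add (V aLo) (V aHi)) (Lit 2)) (Div (Add (V aLo) (V aHi)) (Lit 2))))
        (Store (Lit aLo) (Div (Add (V aLo) (V aHi)) (Lit 2)))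
        (Store (Lit aHi) (Div (Add (V aLo) (V aHi)) (Lit 2)))) m' 1 (\<lambda>m'. \<exists>j<k. I j m')"
    proof (intro runs_Cond[OF _ b] runs_Store[OF _ b])
      assume "0 < val (Sub (Add (V aArg) (Lit 1))
        (Mul (Div (Add (V aLo) (V aHi)) (Lit 2)) (Div (Add (V aLo) (V aHi)) (Lit 2)))) m'"
      then have le: "mid\<^sup>2 \<le> v"
        by (simp add: m' v_def mid_def power2_eq_square)
      have "I j (m(aLo := mid, aHi := h))"
        unfolding I_def
        by (rule exI[of _ mid], rule exI[of _ h]) (use le l h mid lh v0 in auto)
      then show "\<exists>j<k. I j (m'(val (Lit aLo) m' := val (Div (Add (V aLo) (V aHi)) (Lit 2)) m'))"
        by (intro exI[of _ j]) (simp add: j m' mid_def fun_upd_twist)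
    next
      assume "val (Sub (Add (V aArg) (Lit 1))
        (Mul (Div (Add (V aLo) (V aHi)) (Lit 2)) (Div (Add (V aLo) (V aHi)) (Lit 2)))) m' \<le> 0"
      then have less: "v < mid\<^sup>2"
        by (simp add: m' v_def mid_def power2_eq_square)
      have "I j (m(aLo := l, aHi := mid))"
        unfolding I_def
        by (rule exI[of _ l], rule exI[of _ mid]) (use less l h mid lh v0 in auto)
      then show "\<exists>j<k. I j (m'(val (Lit aHi) m' := val (Div (Add (V aLo) (V aHi)) (Lit 2)) m'))"
        by (intro exI[of _ j]) (simp add: j m' mid_def fun_upd_twist)
    qed (use l h mid in \<open>simp_all add: m' mid_def\<close>)
  next
    fix k m'
    assume "I k m'" and "val (Sub (Sub (V aHi) (V aLo)) (Lit 1)) m' \<le> 0"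
    then obtain l h where m': "m' = m(aLo := l, aHi := h)" and l: "0 \<le> l"
      and lh: "h \<le> l + 1" "if 0 \<le> v then l\<^sup>2 \<le> v \<and> v < h\<^sup>2 \<and> l < h else l = 0 \<and> h \<le> 0"
      unfolding I_def by auto
    have "l = int (floor_sqrt (nat v))"
    proof (cases "0 \<le> v")
      case True
      with lh have "h = l + 1"
        by simp
      with lh(2) True have "l\<^sup>2 \<le> v" "v < (l + 1)\<^sup>2"
        by simp_all
      with l True have "(nat l)\<^sup>2 \<le> nat v" "nat v < (Suc (nat l))\<^sup>2"
        by (simp_all add: nat_le_eq_zle nat_less_iff flip: nat_power_eq) (simp add: add.commute)
      then have "floor_sqrt (nat v) = nat l"
        by (rule floor_sqrt_unique)
      with l show ?thesis
        by simp
    qed (use lh in simp)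
    with Q[of h] show "Q m'"
      by (simp add: m' v_def)
  next
    show "I b ((m(val (Lit aLo) m := val (Lit 0) m))
        (val (Lit aHi) (m(val (Lit aLo) m := val (Lit 0) m)) :=
          val (Add (V aArg) (Lit 1)) (m(val (Lit aLo) m := val (Lit 0) m))))"
      unfolding I_def
      by (rule exI[of _ 0], rule exI[of _ "v + 1"])
        (use v in \<open>auto simp: v_def power2_eq_square algebra_simps intro!: add_pos_nonneg\<close>)
  qed (use v s in auto)
qed

section \<open>Correctness and running time of the search\<close>

text \<open>Both branches are merged into one \<open>max\<close>, so that the symbolic execution of
  the remaining step does not fork.\<close>

lemma runs_clip:
  assumes "1 \<le> s" and "1 \<le> b" and "Q (m(aX := max 0 (m aX)))"
  shows "runs b (Cond (V aX) Skip (Set aX (Lit 0))) m s Q"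
proof (intro runs_Cond runs_Skip runs_Store)
  assume "0 < val (V aX) m"
  then have "m(aX := max 0 (m aX)) = m"
    by auto
  with assms(3) show "Q m"
    by simp
next
  assume "val (V aX) m \<le> 0"
  with assms(3) show "Q (m(val (Lit aX) m := val (Lit 0) m))"
    by simp
qed (use assms in auto)

locale box_search =
  fixes c :: "nat list" and R :: nat
  assumes nonempty: "1 \<le> length c" and pos: "\<And>i. i < length c \<Longrightarrow> 0 < c ! i"
begin

section \<open>Mathematical values of the candidates and their size\<close>

text \<open>The counter \<open>k\<close> encodes the candidate with \<open>X k i\<close> in the coordinates \<open>i\<close> from \<open>1\<close> to \<open>n - 1\<close> and
  \<open>head k\<close> in the coordinate \<open>0\<close>.\<close>

definition n :: nat where "n = length c"
definition cf :: "nat \<Rightarrow> int" where "cf i = int (c ! i)"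
definition S :: int where "S = (\<Sum>i<n. cf i * cf i)"
text \<open>The distance bound sqrt(2 r sqrt n) equals the fourth root of 4 R n, whose integer part
  is the nested root. The summand 1 pays for replacing y_i by its floor.\<close>

definition D :: int where "D = int (floor_sqrt (floor_sqrt (4 * R * n))) + 1"
definition B :: int where "B = 2 * D + 1"
text \<open>This is the floor of y_i = r c_i / ||c||, computed without irrational numbers; see
  \<open>centre_floor\<close>.\<close>

definition centre :: "nat \<Rightarrow> int"
  where "centre i = int (floor_sqrt (nat (int R * (cf i * cf i) div S)))"
definition X :: "int \<Rightarrow> nat \<Rightarrow> int"
  where "X k i = max 0 (centre i - D + k div B ^ (i - 1) mod B)"
definition rem :: "int \<Rightarrow> nat \<Rightarrow> int"
  where "rem k i = int R - (\<Sum>j\<in>{1..<i}. X k j * X k j)"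
definition part :: "int \<Rightarrow> nat \<Rightarrow> int"
  where "part k i = (\<Sum>j\<in>{1..<i}. cf j * X k j)"
definition head :: "int \<Rightarrow> int"
  where "head k = int (floor_sqrt (nat (rem k n)))"
definition score :: "int \<Rightarrow> int"
  where "score k = (if 0 \<le> rem k n then part k n + cf 0 * head k else - 1)"

lemma n_pos: "1 \<le> n"
  using nonempty by (simp add: n_def)

lemma cf_pos: "i < n \<Longrightarrow> 0 < cf i"
  using pos by (simp add: n_def cf_def)

lemma cf_square_le_S: "i < n \<Longrightarrow> cf i * cf i \<le> S"
  unfolding S_def by (intro member_le_sum) auto

lemma S_pos: "0 < S"
  using cf_square_le_S[of 0] cf_pos[of 0] n_pos mult_pos_pos[of "cf 0" "cf 0"] by linarith

lemma D_pos: "1 \<le> D"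
  by (simp add: D_def)

lemma B_pos: "0 < B"
  using D_pos by (simp add: B_def)

lemma quotient_bounds:
  assumes "i < n"
  shows "0 \<le> int R * (cf i * cf i) div S" and "int R * (cf i * cf i) div S \<le> int R"
proof -
  show "0 \<le> int R * (cf i * cf i) div S"
    using S_pos by (simp add: pos_imp_zdiv_nonneg_iff)
  have "int R * (cf i * cf i) \<le> int R * S"
    using cf_square_le_S[OF assms] by (intro mult_left_mono) auto
  then have "int R * (cf i * cf i) div S \<le> int R * S div S"
    using S_pos by (intro zdiv_mono1)
  then show "int R * (cf i * cf i) div S \<le> int R"
    using S_pos by simp
qed

lemma centre_le: "i < n \<Longrightarrow> centre i \<le> int R"
  unfolding centre_def using quotient_bounds(2)[of i]
    floor_sqrt_le[of "nat (int R * (cf i * cf i) div S)"] by linarith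

lemma X_nonneg: "0 \<le> X k i"
  by (simp add: X_def)

lemma X_le:
  assumes "i < n"
  shows "X k i \<le> int R + D"
proof -
  have "k div B ^ (i - 1) mod B \<le> 2 * D"
    using B_pos pos_mod_bound[of B "k div B ^ (i - 1)"] by (simp add: B_def)
  then show ?thesis
    using centre_le[OF assms] D_pos by (simp add: X_def)
qed

lemma rem_Suc: "1 \<le> i \<Longrightarrow> rem k (Suc i) = rem k i - X k i * X k i"
  by (simp add: rem_def atLeastLessThanSuc)

lemma part_Suc: "1 \<le> i \<Longrightarrow> part k (Suc i) = part k i + cf i * X k i"
  by (simp add: part_def atLeastLessThanSuc)

lemma rem_le: "rem k i \<le> int R"
  by (simp add: rem_def sum_nonneg)

text \<open>Box points may lie far outside the ball, and their negative remainders are stored as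
  well, so their size has to be controlled.\<close>

lemma rem_ge:
  assumes "i \<le> n"
  shows "- (int n * ((int R + D) * (int R + D))) \<le> rem k i"
proof -
  have "(\<Sum>j\<in>{1..<i}. X k j * X k j) \<le> (\<Sum>j\<in>{1..<i}. (int R + D) * (int R + D))"
    using assms X_le X_nonneg D_pos by (intro sum_mono mult_mono) auto
  also have "\<dots> \<le> int n * ((int R + D) * (int R + D))"
    using assms by (simp add: mult_right_mono)
  finally show ?thesis
    by (simp add: rem_def)
qed

lemma head_nonneg: "0 \<le> head k"
  by (simp add: head_def)

lemma head_le: "head k \<le> int R"
  unfolding head_def using rem_le[of k n] floor_sqrt_le[of "nat (rem k n)"] by linarith

lemma part_nonneg: "i \<le> n \<Longrightarrow> 0 \<le> part k i"
  unfolding part_def using cf_pos X_nonneg by (intro sum_nonneg mult_nonneg_nonneg) (auto intro: less_imp_le)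

lemma part_add_head_le:
  assumes "i \<le> n" and "h \<le> int R"
  shows "part k i + cf 0 * h \<le> (\<Sum>j<n. cf j) * (int R + D)"
proof -
  have "part k i \<le> (\<Sum>j\<in>{1..<i}. cf j * (int R + D))"
    unfolding part_def using assms(1) X_le cf_pos
    by (intro sum_mono mult_left_mono) (auto intro: less_imp_le)
  also have "\<dots> \<le> (\<Sum>j\<in>{1..<n}. cf j * (int R + D))"
    using assms(1) D_pos by (intro sum_mono2) (auto simp: cf_def)
  finally have "part k i \<le> \<dots>" .
  moreover have "cf 0 * h \<le> cf 0 * (int R + D)"
    using assms(2) D_pos by (intro mult_left_mono) (auto simp: cf_def)
  moreover have "{..<n} = insert 0 {1..<n}"
    using n_pos by auto
  ultimately show ?thesis
    by (simp add: sum_distrib_right distrib_right)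
qed

lemma part_le: "i \<le> n \<Longrightarrow> part k i \<le> (\<Sum>j<n. cf j) * (int R + D)"
  using part_add_head_le[of i 0 k] by simp

definition env :: "memory \<Rightarrow> bool" where
  "env m \<longleftrightarrow> m 0 = int n \<and> m 1 = int R \<and> m aC0 = cf 0 \<and> m aS = S \<and> m aD = D \<and> m aB = B"

text \<open>The lower index is a parameter because the output phase overwrites coefficients that
  have already been read.\<close>

definition coeffs :: "nat \<Rightarrow> memory \<Rightarrow> bool"
  where "coeffs i m \<longleftrightarrow> (\<forall>j. i \<le> j \<and> j < n \<longrightarrow> m (int j + 2) = cf j)"

text \<open>With \<open>n + 1\<close> in \<open>aW\<close> the protected range is the whole input;
  with 1 it is only n and R.\<close>

definition unchanged :: "memory \<Rightarrow> memory \<Rightarrow> bool"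
  where "unchanged m m' \<longleftrightarrow> (\<forall>a. a \<le> -20 \<or> 0 \<le> a \<and> a \<le> m aW \<longrightarrow> m' a = m a)"

end

text \<open>These are the size conditions that the assignments of the program give rise to. They are
  strict where a number is passed to the square root, since bisection stores that number plus
  1.\<close>

locale bounded_box_search = box_search +
  fixes b :: nat
  assumes b: "1 \<le> b"
    and b_n: "int n + 1 \<le> 2 ^ b"
    and b_cf: "\<And>i. i < n \<Longrightarrow> cf i \<le> 2 ^ b"
    and b_nR: "4 * int R * int n < 2 ^ b"
    and b_S: "S \<le> 2 ^ b"
    and b_B: "int R + B \<le> 2 ^ b"
    and b_power: "B ^ (n - 1) \<le> 2 ^ b"
    and b_rem: "int R + int n * ((int R + D) * (int R + D)) < 2 ^ b"
    and b_score: "(\<Sum>j<n. cf j) * (int R + D) \<le> 2 ^ b"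
begin

lemma runs_step:
  assumes env: "env m" and coeffs: "coeffs i m" and i: "1 \<le> i" "i < n"
    and w: "m aW = 1 \<or> m aW = int n + 1"
    and k: "0 \<le> k" "k \<le> 2 ^ b"
    and m: "m aI = int i" "m aT = k div B ^ (i - 1)" "m aRem = rem k i" "m aVal = part k i"
    and s: "b + 1 \<le> s"
    and Q: "\<And>z h. Q (m(aArg := z, aLo := centre i, aHi := h, aX := X k i, aT := k div B ^ i,
      aRem := rem k (i + 1), aVal := part k (i + 1), m aW + int i := X k i, aI := int i + 1))"
  shows "runs b step_prog m s Q"
proof -
  have s1: "1 \<le> s"
    using s by simp
  have R: "int R < 2 ^ b"
    using b_rem D_pos by (smt (verit) mult_nonneg_nonneg of_nat_0_le_iff)
  have ci: "m (int i + 2) = cf i"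
    using coeffs i by (simp add: coeffs_def)
  have cell: "m 1 = int R" "m aS = S" "m aD = D" "m aB = B"
    using env by (auto simp: env_def)
  have "k div B ^ (i - 1) \<le> k"
    using k(1) B_pos zdiv_mono2[of k 1 "B ^ (i - 1)"] by simp
  define t where "t = k div B ^ (i - 1)"
  have mem: "m aI = int i" "m aT = t" "m aRem = rem k i" "m aVal = part k i"
    using m by (simp_all add: t_def)
  have t: "0 \<le> t" "t \<le> 2 ^ b"
    using k B_pos \<open>k div B ^ (i - 1) \<le> k\<close> by (auto simp: t_def pos_imp_zdiv_nonneg_iff)
  have tdiv: "t div B = k div B ^ i" "0 \<le> t div B" "t div B \<le> 2 ^ b"
  proof -
    have "B ^ i = B ^ (i - 1) * B"
      using i(1) by (cases i) auto
    then show "t div B = k div B ^ i"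
      using B_pos by (simp add: t_def zdiv_zmult2_eq)
    show "0 \<le> t div B"
      using t B_pos by (simp add: pos_imp_zdiv_nonneg_iff)
    have "t div B \<le> t"
      using t B_pos zdiv_mono2[of t 1 B] by simp
    with t show "t div B \<le> 2 ^ b"
      by simp
  qed
  define x where "x = centre i - D + (t - t div B * B)"
  have x: "max 0 x = X k i"
    by (simp add: x_def X_def t_def minus_div_mult_eq_mod)
  have x_bound: "\<bar>x\<bar> \<le> 2 ^ b"
  proof -
    have "0 \<le> centre i"
      by (simp add: centre_def)
    moreover have "B = 2 * D + 1"
      by (rule B_def)
    ultimately show ?thesis
      using centre_le[OF i(2)] b_B D_pos pos_mod_bound[OF B_pos, of t] pos_mod_sign[OF B_pos, of t]
      unfolding x_def minus_div_mult_eq_mod by linarith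
  qed
  have rem_bound: "\<bar>rem k i - X k i * X k i\<bar> \<le> 2 ^ b"
    using rem_le[of k "Suc i"] rem_ge[OF Suc_leI[OF i(2)], of k] b_rem R
    unfolding rem_Suc[OF i(1)] by linarith
  have part_bound: "\<bar>part k i + cf i * X k i\<bar> \<le> 2 ^ b"
    using part_le[OF Suc_leI[OF i(2)], of k] part_nonneg[OF Suc_leI[OF i(2)], of k] b_score
    unfolding part_Suc[OF i(1)] by linarith
  have X_bound: "\<bar>X k i\<bar> \<le> 2 ^ b"
    using X_le[OF i(2), of k] X_nonneg[of k i] b_B D_pos
    by (simp add: B_def)
  have quotient: "\<bar>int R * (cf i * cf i) div S\<bar> < 2 ^ b"
    using quotient_bounds[OF i(2)] R by linarith
  have w': "1 \<le> m aW"
    using w by auto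
  show ?thesis
    \<comment> \<open>Symbolic execution, one assignment at a time; the facts inserted by
      \<open>using\<close> bound the value about to be stored.\<close>
    unfolding step_prog_def Let_def
    apply (rule runs_Seq, rule runs_Store[OF s1 b])
     apply (simp add: ci cell mem)
    using quotient
     apply simp
    apply (simp add: ci cell mem)
    apply (rule runs_Seq, rule runs_floor_sqrt[OF b s])
    using quotient
     apply simp
    apply (simp flip: centre_def)
    apply (rule runs_Seq, rule runs_Store[OF s1 b])
    using x_bound
     apply (simp add: ci cell mem x_def)
    apply (simp add: ci cell mem flip: x_def)
    apply (rule runs_Seq, rule runs_clip[OF s1 b])
    apply (simp add: x)
    apply (rule runs_Seq, rule runs_Store[OF s1 b])
    using tdiv
     apply (simp add: cell mem)
    apply (simp add: cell mem tdiv)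
    apply (rule runs_Seq, rule runs_Store[OF s1 b])
    using rem_bound
     apply (simp add: mem)
    apply (simp add: mem flip: rem_Suc[OF i(1)])
    apply (rule runs_Seq, rule runs_Store[OF s1 b])
    using part_bound
     apply (simp add: mem ci)
    apply (simp add: mem ci flip: part_Suc[OF i(1)])
    apply (rule runs_Seq, rule runs_Store[OF s1 b])
    using X_bound
     apply simp
    apply (simp add: mem)
    apply (rule runs_Store[OF s1 b])
    using b_n i w'
     apply (simp add: mem)
    using Q w'
    apply (simp add: mem add.commute)
    done
qed

lemma env_unchanged: "env m \<Longrightarrow> 1 \<le> m aW \<Longrightarrow> unchanged m m' \<Longrightarrow> env m'"
  by (simp add: env_def unchanged_def)

lemma score_bound: "\<bar>part k n + cf 0 * head k\<bar> \<le> 2 ^ b"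
proof -
  have "0 \<le> cf 0 * head k"
    using head_nonneg[of k] by (simp add: cf_def)
  then show ?thesis
    using part_add_head_le[OF order_refl head_le[of k], of k] part_nonneg[OF order_refl, of k]
      b_score by linarith
qed

lemma abs_score_le: "\<bar>score k\<bar> \<le> 2 ^ b"
  using score_bound[of k] by (simp add: score_def)

lemma runs_candidate:
  assumes env: "env m" and coeffs: "coeffs 1 m"
    and w: "m aW = 1 \<or> m aW = int n + 1"
    and k: "m aK = k" "0 \<le> k" "k \<le> 2 ^ b"
    and s: "n * (b + 1) \<le> s"
    and Q: "\<And>m'. unchanged m m' \<Longrightarrow> m' aVal = score k \<Longrightarrow> m' aLo = head k \<Longrightarrow>
      (\<And>j. 1 \<le> j \<Longrightarrow> j < n \<Longrightarrow> m' (m aW + int j) = X k j) \<Longrightarrow> Q m'"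
  shows "runs b candidate_prog m s Q"
proof -
  have "1 * (b + 1) \<le> n * (b + 1)"
    using n_pos by (rule mult_le_mono1)
  then have sb: "b + 1 \<le> s"
    using s by simp
  then have s1: "1 \<le> s"
    by simp
  define w where "w = m aW"
  have w1: "1 \<le> w"
    using w by (auto simp: w_def)
  define I where "I r m' \<longleftrightarrow> (\<exists>i. 1 \<le> i \<and> i \<le> n \<and> r = n - i \<and> m' aI = int i \<and> m' aT = k div B ^ (i - 1) \<and>
    m' aRem = rem k i \<and> m' aVal = part k i \<and> unchanged m m' \<and> coeffs i m' \<and>
    (\<forall>j. 1 \<le> j \<and> j < i \<longrightarrow> m' (w + int j) = X k j))" for r m'
  have R: "int R < 2 ^ b"
    using b_rem D_pos by (smt (verit) mult_nonneg_nonneg of_nat_0_le_iff)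
  have R': "\<bar>m 1\<bar> \<le> 2 ^ b"
    using env R by (simp add: env_def)
  have rem_bound: "\<bar>rem k n\<bar> < 2 ^ b"
    using rem_le[of k n] rem_ge[OF order_refl, of k] b_rem R by linarith
  have step: "runs b step_prog m' (b + 1) (\<lambda>m''. \<exists>r'<r. I r' m'')"
    if I: "I r m'" and test: "0 < val (Sub (V 0) (V aI)) m'" for r m'
  proof -
    from I obtain i where i: "1 \<le> i" "r = n - i"
      and mem: "m' aI = int i" "m' aT = k div B ^ (i - 1)" "m' aRem = rem k i" "m' aVal = part k i"
      and u: "unchanged m m'" and coeffs': "coeffs i m'"
      and X: "\<And>j. 1 \<le> j \<Longrightarrow> j < i \<Longrightarrow> m' (w + int j) = X k j"
      unfolding I_def by blast
    have env': "env m'"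
      using env_unchanged[OF env _ u] w1 by (simp add: w_def)
    with test have "i < n"
      by (simp add: mem env_def)
    have w': "m' aW = w"
      using u by (simp add: unchanged_def w_def)
    show ?thesis
    proof (rule runs_step[OF env' coeffs' i(1) \<open>i < n\<close> _ k(2,3) mem])
      show "m' aW = 1 \<or> m' aW = int n + 1"
        using w by (simp add: w' w_def)
      fix z h
      let ?m = "m'(aArg := z, aLo := centre i, aHi := h, aX := X k i, aT := k div B ^ i,
        aRem := rem k (i + 1), aVal := part k (i + 1), m' aW + int i := X k i, aI := int i + 1)"
      have "unchanged m ?m"
        using u w1 i(1) by (auto simp: unchanged_def w' w_def[symmetric])
      \<comment> \<open>In the output phase the write hits cell \<open>i + 1\<close>, which held
        coefficient \<open>i - 1\<close>; in the search it hits a cell behind the input. The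
        coefficients from \<open>i + 1\<close> on survive in both cases.\<close>
      moreover have "coeffs (i + 1) ?m"
        using coeffs' w i(1) unfolding coeffs_def by (auto simp: w' w_def)
      moreover have "?m (w + int j) = X k j" if "1 \<le> j" "j < i + 1" for j
        using X[of j] that w1 by (auto simp: w')
      ultimately have "I (n - (i + 1)) ?m"
        unfolding I_def using \<open>i < n\<close> w1 by (intro exI[of _ "i + 1"]) (auto simp: w')
      then show "\<exists>r'<r. I r' ?m"
        using i \<open>i < n\<close> by (intro exI[of _ "n - (i + 1)"]) auto
    qed simp
  qed
  have finish: "runs b (Seq (Set aArg (V aRem)) (Seq floor_sqrt_prog
      (Cond (Add (V aRem) (Lit 1)) (Set aVal (Add (V aVal) (Mul (V aC0) (V aLo))))
        (Set aVal (Lit (- 1)))))) m' s Q"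
    if I: "I r m'" and test: "val (Sub (V 0) (V aI)) m' \<le> 0" for r m'
  proof -
    from I obtain i where i: "1 \<le> i" "i \<le> n"
      and mem: "m' aI = int i" "m' aRem = rem k i" "m' aVal = part k i"
      and u: "unchanged m m'"
      and X: "\<And>j. 1 \<le> j \<Longrightarrow> j < i \<Longrightarrow> m' (w + int j) = X k j"
      unfolding I_def by blast
    have env': "env m'"
      using env_unchanged[OF env _ u] w1 by (simp add: w_def)
    with test i have [simp]: "i = n"
      by (simp add: mem env_def)
    have c0: "m' aC0 = cf 0"
      using env' by (simp add: env_def)
    have Q': "Q m''" if "m'' aVal = score k" "m'' aLo = head k"
      and "\<And>a. a \<notin> {aArg, aLo, aHi, aVal} \<Longrightarrow> m'' a = m' a" for m''
    proof (rule Q)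
      show "unchanged m m''"
        using u that(3) by (simp add: unchanged_def)
      show "m'' (m aW + int j) = X k j" if "1 \<le> j" "j < n" for j
        using X[of j] that w1 \<open>\<And>a. a \<notin> {aArg, aLo, aHi, aVal} \<Longrightarrow> m'' a = m' a\<close>
        by (simp add: w_def)
    qed (use that in auto)
    show ?thesis
      apply (rule runs_Seq, rule runs_Store[OF s1 b])
      using rem_bound
       apply (simp add: mem)
      apply (simp add: mem)
      apply (rule runs_Seq, rule runs_floor_sqrt[OF b sb])
      using rem_bound
       apply simp
      apply (simp flip: head_def)
      apply (rule runs_Cond[OF s1 b]; rule runs_Store[OF s1 b])
      using score_bound[of k]
         apply (simp add: mem c0)
        apply (rule Q'; simp add: mem c0 score_def)
       apply simp
      apply (rule Q'; simp add: mem c0 score_def)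
      done
  qed
  show ?thesis
    unfolding candidate_prog_def
    apply (rule runs_Seq, rule runs_Store[OF s1 b])
    using k
     apply simp
    apply (simp add: k)
    apply (rule runs_Seq, rule runs_Store[OF s1 b])
    using R'
     apply simp
    apply simp
    apply (rule runs_Seq, rule runs_Store[OF s1 b])
     apply simp
    apply simp
    apply (rule runs_Seq, rule runs_Store[OF s1 b])
     apply simp
    apply simp
    \<comment> \<open>At most \<open>n - 1\<close> rounds and the exit test, at \<open>b + 1\<close>
      units each, give the \<open>n * (b + 1)\<close> of the hypothesis.\<close>
    apply (rule runs_Seq, rule runs_While[where I = I and k = "n - 1" and s = "b + 1", OF _ b step finish])
         apply simp_all
    subgoal
      unfolding I_def using n_pos env coeffs
      apply (intro exI[of _ 1])
      apply (auto simp: unchanged_def coeffs_def rem_def part_def env_def)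
      done
    using s n_pos
    apply (cases n)
     apply simp_all
    done
qed

section \<open>The loop over all counters\<close>

definition boxes :: nat where "boxes = nat (B ^ (n - 1))"

lemma int_boxes: "int boxes = B ^ (n - 1)"
  using B_pos by (simp add: boxes_def)

lemma boxes_pos: "1 \<le> boxes"
  using B_pos int_boxes by (smt (verit) of_nat_less_iff zero_less_power of_nat_0 less_one linorder_not_less)

definition ready :: "memory \<Rightarrow> bool" where
  "ready m \<longleftrightarrow> env m \<and> coeffs 1 m \<and> m aW = int n + 1 \<and>
    m aK = int boxes \<and> m aBest = - 1 \<and> m aArgBest = 0"

lemma runs_setup:
  assumes "n * (b + 1) \<le> s" and Q: "\<And>m. ready m \<Longrightarrow> Q m"
  shows "runs b setup_prog (input_mem c R) s Q"
proof -
  have "1 * (b + 1) \<le> n * (b + 1)"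
    using n_pos by (rule mult_le_mono1)
  then have sb: "b + 1 \<le> s"
    using assms(1) by simp
  then have s1: "1 \<le> s"
    by simp
  define m where "m = input_mem c R"
  have m: "m 0 = int n" "m 1 = int R" "m 2 = cf 0"
    using n_pos by (auto simp: m_def input_mem_def n_def cf_def)
  have mc: "m (int j + 2) = cf j" if "j < n" for j
    using that by (simp add: m_def input_mem_def n_def cf_def nat_add_distrib)
  define I where "I r m' \<longleftrightarrow> (\<exists>i. 1 \<le> i \<and> i \<le> n \<and> r = n - i \<and> m' aI = int i \<and>
    m' aS = (\<Sum>j<i. cf j * cf j) \<and> m' aK = B ^ (i - 1) \<and> m' 0 = int n \<and> m' 1 = int R \<and>
    m' aC0 = cf 0 \<and> m' aD = D \<and> m' aB = B \<and> m' aW = int n + 1 \<and> m' aBest = - 1 \<and>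
    m' aArgBest = 0 \<and> coeffs 1 m')" for r m'
  have step: "runs b (Seq (Set aS (Add (V aS) (Mul (Cell (Add (V aI) (Lit 2))) (Cell (Add (V aI) (Lit 2))))))
      (Seq (Set aK (Mul (V aK) (V aB))) (Set aI (Add (V aI) (Lit 1))))) m' 1 (\<lambda>m''. \<exists>r'<r. I r' m'')"
    if I: "I r m'" and test: "0 < val (Sub (V 0) (V aI)) m'" for r m'
  proof -
    from I obtain i where i: "1 \<le> i" "r = n - i"
      and mem: "m' aI = int i" "m' aS = (\<Sum>j<i. cf j * cf j)" "m' aK = B ^ (i - 1)" "m' 0 = int n"
        "m' 1 = int R" "m' aC0 = cf 0" "m' aD = D" "m' aB = B" "m' aW = int n + 1" "m' aBest = - 1"
        "m' aArgBest = 0" and coeffs: "coeffs 1 m'"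
      unfolding I_def by blast
    from test have "i < n"
      by (simp add: mem)
    have ci: "m' (int i + 2) = cf i"
      using coeffs i \<open>i < n\<close> by (simp add: coeffs_def)
    have "(\<Sum>j<Suc i. cf j * cf j) \<le> S"
      unfolding S_def using \<open>i < n\<close> by (intro sum_mono2) auto
    moreover have "0 \<le> (\<Sum>j<Suc i. cf j * cf j)"
      by (intro sum_nonneg) simp
    ultimately have sum_bound: "\<bar>(\<Sum>j<i. cf j * cf j) + cf i * cf i\<bar> \<le> 2 ^ b"
      using b_S by simp
    have power: "B ^ (i - Suc 0) * B = B ^ i"
      using i(1) by (cases i) auto
    have one: "1 \<le> Suc 0"
      by simp
    have "B ^ i \<le> B ^ (n - 1)"
      using \<open>i < n\<close> B_pos by (intro power_increasing) auto
    then have power_bound: "\<bar>B ^ i\<bar> \<le> 2 ^ b"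
      using b_power B_pos by simp
    show ?thesis
      apply (rule runs_Seq, rule runs_Store[OF order_refl b])
      using sum_bound
       apply (simp add: mem ci)
      apply (simp add: mem ci)
      apply (rule runs_Seq, rule runs_Store[OF one b])
      using power_bound
       apply (simp add: mem power)
      apply (simp add: mem power)
      apply (rule runs_Store[OF one b])
      using b_n \<open>i < n\<close>
       apply (simp add: mem)
      apply (simp add: mem)
      apply (rule exI[of _ "n - Suc i"])
      unfolding I_def using coeffs i \<open>i < n\<close>
      apply (intro conjI exI[of _ "Suc i"])
                      apply (auto simp: mem coeffs_def)
      done
  qed
  have finish: "Q m'" if I: "I r m'" and test: "val (Sub (V 0) (V aI)) m' \<le> 0" for r m'
  proof -
    from I obtain i where i: "1 \<le> i" "i \<le> n" "m' aI = int i" "m' 0 = int n"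
      unfolding I_def by blast
    with test have "i = n"
      by simp
    with I i have "ready m'"
      unfolding I_def ready_def env_def S_def int_boxes by auto
    then show ?thesis
      by (rule Q)
  qed
  have R: "\<bar>int R\<bar> \<le> 2 ^ b"
    using b_rem D_pos by (smt (verit) mult_nonneg_nonneg of_nat_0_le_iff)
  have c0: "\<bar>cf 0\<bar> \<le> 2 ^ b"
    using b_cf[of 0] n_pos by (simp add: cf_def)
  have cc0: "\<bar>cf 0 * cf 0\<bar> \<le> 2 ^ b"
    using cf_square_le_S[of 0] n_pos b_S by (simp add: cf_def)
  have int4: "4 * (int R * int n) = int (4 * R * n)"
    by simp
  have nat4: "nat (4 * (int R * int n)) = 4 * R * n"
    unfolding int4 by (rule nat_int)
  have nR: "\<bar>4 * (int R * int n)\<bar> < 2 ^ b"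
    using b_nR by (simp add: mult.assoc)
  have f: "int (floor_sqrt (4 * R * n)) < 2 ^ b"
  proof -
    have "int (floor_sqrt (4 * R * n)) \<le> int (4 * R * n)"
      using floor_sqrt_le by (rule of_nat_mono)
    also have "\<dots> < 2 ^ b"
      using nR unfolding int4 by (rule le_less_trans[OF abs_ge_self])
    finally show ?thesis .
  qed
  have DB: "1 + int (floor_sqrt (floor_sqrt (4 * R * n))) = D" "1 + 2 * D = B"
    by (simp_all add: D_def B_def)
  have D_bound: "\<bar>D\<bar> \<le> 2 ^ b" "\<bar>B\<bar> \<le> 2 ^ b"
    using D_pos b_B by (simp_all add: B_def)
  have mw: "coeffs 1 m"
    by (simp add: coeffs_def mc)
  show ?thesis
    unfolding setup_prog_def Let_def m_def[symmetric]
    apply (rule runs_Seq, rule runs_Store[OF s1 b])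
    using c0
     apply (simp add: m)
    apply (simp add: m)
    apply (rule runs_Seq, rule runs_Store[OF s1 b])
    using cc0
     apply (simp add: m)
    apply (simp add: m)
    apply (rule runs_Seq, rule runs_Store[OF s1 b])
    using nR
     apply (simp add: m)
    apply (simp add: m)
    apply (rule runs_Seq, rule runs_floor_sqrt[OF b sb])
    using nR
     apply (simp add: m)
    apply (simp add: nat4)
    apply (rule runs_Seq, rule runs_Store[OF s1 b])
    using f
     apply simp
    apply simp
    apply (rule runs_Seq, rule runs_floor_sqrt[OF b sb])
    using f
     apply simp
    apply simp
    apply (rule runs_Seq, rule runs_Store[OF s1 b])
    using D_bound DB
     apply (simp add: add.commute)
    apply (simp add: DB add.commute)
    apply (rule runs_Seq, rule runs_Store[OF s1 b])
    using D_bound DB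
     apply (simp add: add.commute)
    apply (simp add: DB add.commute)
    apply (rule runs_Seq, rule runs_Store[OF s1 b], simp, simp)+
    apply (rule runs_Seq, rule runs_Store[OF s1 b])
    using b_n
     apply (simp add: m)
    apply (simp add: m)
    apply (rule runs_Seq, rule runs_Store[OF s1 b], simp, simp)+
    apply (rule runs_While[where I = I and k = "n - 1", OF order_refl b step finish])
       apply assumption+
    subgoal
      unfolding I_def using n_pos mw
      apply (intro exI[of _ 1])
      apply (auto simp: coeffs_def m)
      done
    using assms(1) n_pos
    apply (cases n)
     apply simp_all
    done
qed

text \<open>Counters from \<open>r\<close> on have been tried. The alternative
  \<open>m aBest = - 1\<close> is needed at the start, where the best value is not yet attained by
  any candidate.\<close>

definition searched :: "nat \<Rightarrow> memory \<Rightarrow> bool" where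
  "searched r m \<longleftrightarrow> env m \<and> coeffs 1 m \<and> m aW = int n + 1 \<and> m aK = int r \<and> r \<le> boxes \<and>
    0 \<le> m aArgBest \<and> m aArgBest < int boxes \<and> - 1 \<le> m aBest \<and>
    (\<forall>k. int r \<le> k \<and> k < int boxes \<longrightarrow> score k \<le> m aBest) \<and>
    (m aBest = - 1 \<or> m aBest = score (m aArgBest))"

lemma runs_search_body:
  assumes m: "searched (Suc r) m" and s: "n * (b + 1) \<le> s"
  shows "runs b (Seq (Set aK (Sub (V aK) (Lit 1)))
      (Seq candidate_prog
        (Cond (Sub (V aVal) (V aBest))
          (Seq (Set aBest (V aVal)) (Set aArgBest (V aK))) Skip))) m s (searched r)"
proof -
  have "1 * (b + 1) \<le> n * (b + 1)"
    using n_pos by (rule mult_le_mono1)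
  then have s1: "1 \<le> s"
    using s by simp
  have "int r < int boxes"
    using m by (simp add: searched_def)
  then have r: "int r < int boxes" "int r \<le> 2 ^ b"
    using b_power unfolding int_boxes by linarith+
  let ?m = "m(aK := int r)"
  have env: "env ?m" "coeffs 1 ?m" "?m aW = 1 \<or> ?m aW = int n + 1"
    using m by (auto simp: searched_def env_def coeffs_def)
  show ?thesis
    apply (rule runs_Seq, rule runs_Store[OF s1 b])
    using m r
     apply (simp add: searched_def)
    using m
    apply (simp add: searched_def)
    apply (rule runs_Seq)
    apply (rule runs_candidate[OF env _ of_nat_0_le_iff[of r] r(2) s])
     apply simp
    subgoal premises prems for m'
    proof -
      note u = prems(2) and v = prems(3)
      have mem: "m' aK = int r" "m' aBest = m aBest" "m' aArgBest = m aArgBest" "m' aW = int n + 1"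
        using u m by (auto simp: unchanged_def searched_def)
      have "env m'" "coeffs 1 m'"
        using u env m by (auto simp: unchanged_def coeffs_def env_def searched_def)
      then have A: "searched r m''"
        if "\<And>a. a \<notin> {aBest, aArgBest} \<Longrightarrow> m'' a = m' a"
          and "if m aBest < score (int r) then m'' aBest = score (int r) \<and> m'' aArgBest = int r
            else m'' aBest = m aBest \<and> m'' aArgBest = m aArgBest" for m''
      proof -
        have *: "k = int r \<or> int (Suc r) \<le> k" if "int r \<le> k" for k
          using that by auto
        have "env m''" "coeffs 1 m''"
          using \<open>env m'\<close> \<open>coeffs 1 m'\<close> that(1) by (auto simp: env_def coeffs_def)
        moreover have "\<forall>k. int r \<le> k \<and> k < int boxes \<longrightarrow> score k \<le> m'' aBest"
          using m that(2) * unfolding searched_def by (auto split: if_splits) (smt (verit))+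
        ultimately show ?thesis
          using m mem r that unfolding searched_def by (auto split: if_splits)
      qed
      show ?thesis
        apply (rule runs_Cond[OF s1 b])
         apply (rule runs_Seq)
         apply (rule runs_Store[OF s1 b])
        using abs_score_le[of "int r"]
          apply (simp add: v)
         apply (rule runs_Store[OF s1 b])
        using r
          apply (simp add: mem)
         apply (rule A)
          apply (simp_all add: mem v)
        apply (rule runs_Skip[OF s1 b])
        apply (rule A)
         apply (simp_all add: mem v)
        done
    qed
    done
qed

text \<open>One candidate per counter and the exit test account for \<open>boxes + 1\<close>. That
  \<open>best\<close> is not -1 cannot be seen from the program; it is left to
  \<open>holds_optimumI\<close>.\<close>

lemma runs_box_search:
  assumes s: "(boxes + 1) * (n * (b + 1)) \<le> s"
    and Q: "\<And>m k best. 0 \<le> k \<Longrightarrow> k < int boxes \<Longrightarrow> m 0 = score k \<Longrightarrow> m 1 = head k \<Longrightarrow>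
      (\<And>j. 1 \<le> j \<Longrightarrow> j < n \<Longrightarrow> m (1 + int j) = X k j) \<Longrightarrow>
      (\<And>k. 0 \<le> k \<Longrightarrow> k < int boxes \<Longrightarrow> score k \<le> best) \<Longrightarrow> best = - 1 \<or> best = score k \<Longrightarrow> Q m"
  shows "runs b box_search_prog (input_mem c R) s Q"
proof -
  have "1 * (n * (b + 1)) \<le> (boxes + 1) * (n * (b + 1))"
    by (rule mult_le_mono1) simp
  then have sn: "n * (b + 1) \<le> s"
    using s by simp
  have "1 * (b + 1) \<le> n * (b + 1)"
    using n_pos by (rule mult_le_mono1)
  then have s1': "1 \<le> n * (b + 1)" and s1: "1 \<le> s"
    using sn by simp_all
  have run_output: "runs b output_prog m s Q" if m: "searched 0 m" for m
  proof -
    define k where "k = m aArgBest"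
    have k: "0 \<le> k" "k < int boxes" "k \<le> 2 ^ b" "\<bar>k\<bar> \<le> 2 ^ b"
      using m b_power int_boxes by (auto simp: searched_def k_def)
    let ?m = "m(aK := k, aW := 1)"
    have env: "env ?m" "coeffs 1 ?m" "?m aW = 1 \<or> ?m aW = int n + 1"
      using m by (auto simp: searched_def env_def coeffs_def)
    have h: "\<bar>head k\<bar> \<le> 2 ^ b"
      using head_nonneg[of k] head_le[of k] b_B B_pos by linarith
    show ?thesis
      unfolding output_prog_def
      apply (rule runs_Seq, rule runs_Store[OF s1 b])
      using k
       apply (simp add: k_def)
      apply (simp add: k_def[symmetric])
      apply (rule runs_Seq, rule runs_Store[OF s1 b])
       apply simp
      apply simp
      apply (rule runs_Seq)
      apply (rule runs_candidate[OF env _ k(1,3) sn])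
       apply simp
      subgoal premises prems for m'
        apply (rule runs_Seq, rule runs_Store[OF s1 b])
        using h prems
         apply simp
        using prems
        apply simp
        apply (rule runs_Store[OF s1 b])
        using abs_score_le[of k]
         apply simp
        apply simp
        apply (rule Q[of k _ "m aBest"])
        using k m
              apply (simp_all add: searched_def k_def)
        done
      done
  qed
  have run_search: "runs b search_prog m s (\<lambda>m. runs b output_prog m s Q)" if m: "searched boxes m" for m
    unfolding search_prog_def
  proof (rule runs_While[where I = searched, OF s1' b _ _ m s])
    fix r m
    assume r: "searched r m" "0 < val (V aK) m"
    then obtain r' where r': "r = Suc r'"
      by (cases r) (auto simp: searched_def)
    show "runs b (Seq (Set aK (Sub (V aK) (Lit 1)))
      (Seq candidate_prog
        (Cond (Sub (V aVal) (V aBest))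
          (Seq (Set aBest (V aVal)) (Set aArgBest (V aK))) Skip))) m (n * (b + 1))
          (\<lambda>m'. \<exists>j<r. searched j m')"
      by (rule runs_mono[OF runs_search_body order_refl]) (use r r' in auto)
  next
    fix r m
    assume r: "searched r m" "val (V aK) m \<le> 0"
    then have "r = 0"
      by (auto simp: searched_def)
    with r show "runs b output_prog m s Q"
      using run_output by simp
  qed
  have "searched boxes m" if "ready m" for m
    using that boxes_pos unfolding ready_def searched_def by auto
  then show ?thesis
    unfolding box_search_prog_def by (intro runs_Seq runs_setup[OF sn] run_search)
qed

end

section \<open>Proximity to the ray\<close>

text \<open>Every digit vector is the expansion of some counter, so the enumeration misses no point
  of the box. The induction splits off the lowest digit, as in Horner's scheme.\<close>

lemma ex_digits:
  fixes B :: int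
  assumes "0 < B" and "\<And>i. i < m \<Longrightarrow> 0 \<le> d i \<and> d i < B"
  shows "\<exists>k. 0 \<le> k \<and> k < B ^ m \<and> (\<forall>i<m. k div B ^ i mod B = d i)"
  using assms(2)
proof (induction m arbitrary: d)
  case 0
  then show ?case
    by (intro exI[of _ 0]) simp
next
  case (Suc m)
  have "\<And>i. i < m \<Longrightarrow> 0 \<le> d (Suc i) \<and> d (Suc i) < B"
    using Suc.prems by simp
  from Suc.IH[of "\<lambda>i. d (Suc i)", OF this] obtain k where k: "0 \<le> k" "k < B ^ m"
    "\<And>i. i < m \<Longrightarrow> k div B ^ i mod B = d (Suc i)"
    by auto
  have d: "0 \<le> d 0" "d 0 < B"
    using Suc.prems[of 0] by simp_all
  let ?k = "d 0 + k * B"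
  have "?k < (k + 1) * B"
    using d(2) by (simp add: algebra_simps)
  also have "\<dots> \<le> B ^ m * B"
    using k(2) assms(1) by (intro mult_right_mono) auto
  finally have "?k < B ^ Suc m"
    by (simp add: mult.commute)
  moreover have "?k div B ^ i mod B = d i" if "i < Suc m" for i
  proof (cases i)
    case 0
    then show ?thesis
      using d by simp
  next
    case (Suc j)
    have "?k div B ^ i = ?k div B div B ^ j"
      using assms(1) by (simp add: Suc zdiv_zmult2_eq)
    also have "?k div B = k"
      using d assms(1) by simp
    finally show ?thesis
      using k(3)[of j] that Suc by simp
  qed
  ultimately show ?case
    using d(1) k(1) assms(1) by (intro exI[of _ ?k]) simp
qed

lemma eucl_norm_square: "(eucl_norm x)\<^sup>2 = real (\<Sum>i<length x. (x ! i)\<^sup>2)"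
  by (simp add: eucl_norm_def L2_set_def sum_nonneg)

lemma feasible_iff: "feasible n R x \<longleftrightarrow> length x = n \<and> (\<Sum>i<n. (x ! i)\<^sup>2) \<le> R"
  unfolding feasible_def eucl_norm_square of_nat_le_iff by auto

text \<open>A natural number is at most its square, so all coordinates of feasible points are
  bounded by R and the feasible set is finite.\<close>

lemma ex_optimal: "\<exists>x. optimal c R x"
proof -
  define F where "F = {x. feasible (length c) R x}"
  have "x ! i \<le> R" if x: "feasible (length c) R x" and i: "i < length c" for x i
  proof -
    have "x ! i \<le> (x ! i)\<^sup>2"
      by (rule power2_nat_le_imp_le) simp
    also have "\<dots> \<le> (\<Sum>i<length c. (x ! i)\<^sup>2)"
      using i by (intro member_le_sum) auto
    finally show ?thesis
      using x by (simp add: feasible_iff)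
  qed
  then have "F \<subseteq> {x. set x \<subseteq> {..R} \<and> length x = length c}"
    unfolding F_def by (auto simp: in_set_conv_nth feasible_iff)
  then have "finite F"
    using finite_lists_length_eq[of "{..R}"] finite_subset by blast
  moreover have "replicate (length c) 0 \<in> F"
    by (simp add: F_def feasible_iff)
  ultimately have "finite (objective c ` F)" "objective c ` F \<noteq> {}"
    by auto
  then obtain x where "x \<in> F" "\<And>y. y \<in> F \<Longrightarrow> objective c y \<le> objective c x"
    using Max_in[of "objective c ` F"] Max_ge[of "objective c ` F"] by fastforce
  then show ?thesis
    by (auto simp: optimal_def is_arg_max_linorder F_def)
qed

text \<open>Expanding the square gives at most \<rho>^2 - 2 \<rho> (\<rho> - \<delta>) + \<rho>^2 =
  2 \<rho> \<delta>.\<close>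

lemma cap_distance:
  fixes a x :: "nat \<Rightarrow> real"
  assumes A: "0 < A" "A\<^sup>2 = (\<Sum>i<n. (a i)\<^sup>2)" and \<rho>: "0 \<le> \<rho>" and x: "(\<Sum>i<n. (x i)\<^sup>2) \<le> \<rho>\<^sup>2"
    and ax: "(\<rho> - \<delta>) * A \<le> (\<Sum>i<n. a i * x i)"
  shows "(\<Sum>i<n. (x i - \<rho> * a i / A)\<^sup>2) \<le> 2 * \<rho> * \<delta>"
proof -
  have "(\<Sum>i<n. (x i - \<rho> * a i / A)\<^sup>2) =
      (\<Sum>i<n. (x i)\<^sup>2) - 2 * (\<rho> / A) * (\<Sum>i<n. a i * x i) + (\<rho> / A)\<^sup>2 * (\<Sum>i<n. (a i)\<^sup>2)"
    by (simp add: power2_diff sum.distrib sum_subtractf sum_distrib_left sum_divide_distrib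
        power_mult_distrib power_divide algebra_simps)
  also have "(\<rho> / A)\<^sup>2 * (\<Sum>i<n. (a i)\<^sup>2) = \<rho>\<^sup>2"
    using A by (simp add: power_divide flip: A(2))
  also have "(\<rho> / A) * ((\<rho> - \<delta>) * A) \<le> (\<rho> / A) * (\<Sum>i<n. a i * x i)"
    using A(1) \<rho> by (intro mult_left_mono[OF ax]) simp
  then have "\<rho> * (\<rho> - \<delta>) \<le> (\<rho> / A) * (\<Sum>i<n. a i * x i)"
    using A(1) by simp
  then have "(\<Sum>i<n. (x i)\<^sup>2) - 2 * (\<rho> / A) * (\<Sum>i<n. a i * x i) + \<rho>\<^sup>2 \<le> 2 * \<rho> * \<delta>"
  proof -
    have "2 * (\<rho> / A) * G = 2 * (\<rho> / A * G)" "\<rho> * (\<rho> - \<delta>) = \<rho>\<^sup>2 - \<rho> * \<delta>" "2 * \<rho> * \<delta> = 2 * (\<rho> * \<delta>)"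
      for G
      by (simp_all add: power2_eq_square right_diff_distrib)
    with \<open>\<rho> * (\<rho> - \<delta>) \<le> _\<close> x show ?thesis
      by simp
  qed
  finally show ?thesis .
qed

context box_search
begin

definition y :: "nat \<Rightarrow> real"
  where "y i = sqrt (real R) * real_of_int (cf i) / sqrt (real_of_int S)"

lemma y_square: "(y i)\<^sup>2 = real R * (real_of_int (cf i))\<^sup>2 / real_of_int S"
  using S_pos by (simp add: y_def power_divide power_mult_distrib)

lemma S_real: "real_of_int S = (\<Sum>i<n. (real_of_int (cf i))\<^sup>2)"
  by (simp add: S_def power2_eq_square)

text \<open>For integers z and real t, z^2 <= t holds iff z^2 <= floor(t). Hence rounding the
  quotient before taking the root does not change the floor of the root.\<close>

lemma centre_floor:
  assumes "i < n"
  shows "real_of_int (centre i) \<le> y i" and "y i < real_of_int (centre i) + 1"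
proof -
  define q where "q = int R * (cf i * cf i) div S"
  define z where "z = floor_sqrt (nat q)"
  have z: "centre i = int z"
    by (simp add: centre_def z_def q_def)
  have qS: "q * S = int R * (cf i * cf i) - int R * (cf i * cf i) mod S"
    by (simp add: q_def minus_mod_eq_div_mult)
  have q: "0 \<le> q" "q * S \<le> int R * (cf i * cf i)" "int R * (cf i * cf i) < (q + 1) * S"
    using quotient_bounds(1)[OF assms] pos_mod_bound[OF S_pos, of "int R * (cf i * cf i)"]
      pos_mod_sign[OF S_pos, of "int R * (cf i * cf i)"]
    unfolding distrib_right qS by (simp_all add: q_def)
  have "z\<^sup>2 \<le> nat q" "nat q < (Suc z)\<^sup>2"
    unfolding z_def by (rule floor_sqrt_power2_le, rule Suc_floor_sqrt_power2_gt)
  then have "int (z\<^sup>2) \<le> q" "q + 1 \<le> int ((Suc z)\<^sup>2)"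
    using q(1) by linarith+
  then have "int (z\<^sup>2) * S \<le> int R * (cf i * cf i)" "int R * (cf i * cf i) < int ((Suc z)\<^sup>2) * S"
    using q(2,3) S_pos mult_right_mono[of "int (z\<^sup>2)" q S]
      mult_right_mono[of "q + 1" "int ((Suc z)\<^sup>2)" S] by linarith+
  then have "real_of_int (int (z\<^sup>2) * S) \<le> real_of_int (int R * (cf i * cf i))"
    "real_of_int (int R * (cf i * cf i)) < real_of_int (int ((Suc z)\<^sup>2) * S)"
    by (simp_all only: of_int_le_iff of_int_less_iff)
  moreover have "(y i)\<^sup>2 * real_of_int S = real_of_int (int R * (cf i * cf i))"
    using S_pos unfolding y_square by (simp add: power2_eq_square)
  ultimately have "(real z)\<^sup>2 * real_of_int S \<le> (y i)\<^sup>2 * real_of_int S"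
    "(y i)\<^sup>2 * real_of_int S < (real z + 1)\<^sup>2 * real_of_int S"
    by (simp_all add: add.commute)
  then have "(real z)\<^sup>2 \<le> (y i)\<^sup>2" "(y i)\<^sup>2 < (real z + 1)\<^sup>2"
    using S_pos by simp_all
  moreover have "0 \<le> y i"
    using S_pos by (simp add: y_def cf_def)
  ultimately show "real_of_int (centre i) \<le> y i" "y i < real_of_int (centre i) + 1"
    by (auto simp: z intro: power2_le_imp_le power2_less_imp_less)
qed

lemma centre_nonneg: "0 \<le> centre i"
  by (simp add: centre_def)

lemma optimal_near_ray:
  assumes x: "optimal c R x"
  shows "(\<Sum>i<n. (real (x ! i) - y i)\<^sup>2) \<le> 2 * sqrt (real R) * sqrt (real n)"
proof -
  have lenx: "length x = n" and normx: "(\<Sum>i<n. (x ! i)\<^sup>2) \<le> R"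
    and best: "\<And>z. feasible n R z \<Longrightarrow> objective c z \<le> objective c x"
    using x by (auto simp: optimal_def is_arg_max_linorder feasible_iff n_def)
  define A where "A = sqrt (real_of_int S)"
  have A: "0 < A" "A\<^sup>2 = (\<Sum>i<n. (real_of_int (cf i))\<^sup>2)"
    using S_pos by (simp_all add: A_def flip: S_real)
  define z where "z = map (\<lambda>i. nat (centre i)) [0..<n]"
  have z: "real (z ! i) = real_of_int (centre i)" if "i < n" for i
    using that centre_nonneg by (simp add: z_def)
  have "real (\<Sum>i<n. (z ! i)\<^sup>2) \<le> (\<Sum>i<n. (y i)\<^sup>2)"
    unfolding of_nat_sum of_nat_power
    by (intro sum_mono power_mono) (auto simp: z centre_floor centre_nonneg)
  also have "\<dots> = real R * real_of_int S / real_of_int S"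
    unfolding S_real sum_distrib_left sum_divide_distrib
    by (simp add: y_square S_real sum_distrib_left)
  also have "\<dots> = real R"
    using S_pos by simp
  finally have "feasible n R z"
    unfolding feasible_iff of_nat_le_iff by (simp add: z_def)
  then have "real (objective c z) \<le> real (objective c x)"
    using best by simp
  then have obj: "(\<Sum>i<n. real_of_int (cf i) * real (z ! i)) \<le> (\<Sum>i<n. real_of_int (cf i) * real (x ! i))"
    by (simp add: objective_def n_def cf_def)
  \<comment> \<open>Cauchy-Schwarz against the all-ones vector; rounding every y_i down loses at
    most the sum of the coefficients, which fixes \<delta> = sqrt n.\<close>
  have "(\<Sum>i<n. real_of_int (cf i)) = (\<Sum>i<n. \<bar>real_of_int (cf i) * 1\<bar>)"
    by (simp add: cf_def)
  also have "\<dots> \<le> A * sqrt (real n)"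
    using L2_set_mult_ineq[of "\<lambda>i. real_of_int (cf i)" "\<lambda>_. 1" "{..<n}"]
    by (simp add: L2_set_def A_def S_real abs_mult)
  finally have sum_cf: "(\<Sum>i<n. real_of_int (cf i)) \<le> A * sqrt (real n)" .
  have "(\<Sum>i<n. real_of_int (cf i) * y i) = sqrt (real R) / A * A\<^sup>2"
    unfolding A(2) by (simp add: y_def A_def power2_eq_square sum_distrib_left algebra_simps)
  also have "\<dots> = sqrt (real R) * A"
    using A(1) by (simp add: power2_eq_square)
  finally have cy: "(\<Sum>i<n. real_of_int (cf i) * y i) = sqrt (real R) * A" .
  have "y i - 1 \<le> real (z ! i)" if "i < n" for i
    using centre_floor(2)[OF that] z[OF that] by simp
  then have "(\<Sum>i<n. real_of_int (cf i) * (y i - 1)) \<le> (\<Sum>i<n. real_of_int (cf i) * real (z ! i))"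
    by (intro sum_mono mult_left_mono) (auto simp: cf_def)
  then have "(sqrt (real R) - sqrt (real n)) * A \<le> (\<Sum>i<n. real_of_int (cf i) * real (x ! i))"
    using obj sum_cf cy by (simp add: algebra_simps sum_subtractf)
  then have "(\<Sum>i<n. (real (x ! i) - sqrt (real R) * real_of_int (cf i) / A)\<^sup>2)
      \<le> 2 * sqrt (real R) * sqrt (real n)"
    using A normx
    by (intro cap_distance[where a = "\<lambda>i. real_of_int (cf i)" and x = "\<lambda>i. real (x ! i)"])
      (simp_all flip: of_nat_power of_nat_sum)
  then show ?thesis
    by (simp add: y_def A_def)
qed

text \<open>A coordinate more than D from the integer \<open>centre i\<close> is at least D + 1 from
  it, hence at least D from y_i. Then D^4 <= 4 R n, although D exceeds the fourth root of 4 R n by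
  construction.\<close>

lemma optimal_in_box:
  assumes x: "optimal c R x" and i: "i < n"
  shows "\<bar>int (x ! i) - centre i\<bar> \<le> D"
proof (rule ccontr)
  assume far: "\<not> \<bar>int (x ! i) - centre i\<bar> \<le> D"
  define e where "e = floor_sqrt (floor_sqrt (4 * R * n)) + 1"
  have e: "D = int e"
    by (simp add: e_def D_def)
  have "real_of_int \<bar>int (x ! i) - centre i\<bar> \<ge> real e + 1"
    using far unfolding e by linarith
  then have "real e \<le> \<bar>real (x ! i) - y i\<bar>"
    using centre_floor[OF i] by (simp add: abs_if split: if_splits)
  then have "(real e)\<^sup>2 \<le> \<bar>real (x ! i) - y i\<bar>\<^sup>2"
    by (rule power_mono) simp
  also have "\<dots> \<le> (\<Sum>i<n. (real (x ! i) - y i)\<^sup>2)"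
    using i by (simp only: power2_abs) (rule member_le_sum; simp)
  also have "\<dots> \<le> sqrt (real (4 * R * n))"
    using optimal_near_ray[OF x] by (simp add: real_sqrt_mult)
  finally have "((real e)\<^sup>2)\<^sup>2 \<le> real (4 * R * n)"
    using power_mono[of "(real e)\<^sup>2" "sqrt (real (4 * R * n))" 2] by simp
  then have "real ((e\<^sup>2)\<^sup>2) \<le> real (4 * R * n)"
    by simp
  then have "(e\<^sup>2)\<^sup>2 \<le> 4 * R * n"
    by (simp only: of_nat_le_iff)
  then have "e \<le> floor_sqrt (floor_sqrt (4 * R * n))"
    by (simp add: le_floor_sqrt_iff)
  then show False
    by (simp add: e_def)
qed

section \<open>Candidates compared with an optimal solution\<close>

definition candidate :: "int \<Rightarrow> nat list"
  where "candidate k = nat (head k) # map (\<lambda>j. nat (X k j)) [1..<n]"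

lemma candidate_0: "int (candidate k ! 0) = head k"
  by (simp add: candidate_def head_nonneg)

lemma candidate_nth: "1 \<le> j \<Longrightarrow> j < n \<Longrightarrow> int (candidate k ! j) = X k j"
  by (simp add: candidate_def nth_Cons' X_nonneg)

lemma sum_split_0: "(\<Sum>j<n. f j) = f 0 + (\<Sum>j\<in>{1..<n}. f j)" for f :: "nat \<Rightarrow> int"
proof -
  have "{..<n} = insert 0 {1..<n}"
    using n_pos by auto
  then show ?thesis
    by simp
qed

lemma candidate_feasible:
  assumes "0 \<le> rem k n"
  shows "feasible n R (candidate k)"
proof -
  have "int ((nat (head k))\<^sup>2) \<le> int (nat (rem k n))"
    unfolding of_nat_le_iff by (simp add: head_def)
  then have "head k * head k \<le> rem k n"
    using assms head_nonneg by (simp add: power2_eq_square)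
  then have "int (\<Sum>j<n. (candidate k ! j)\<^sup>2) \<le> int R"
    by (simp add: sum_split_0 candidate_0 candidate_nth power2_eq_square rem_def)
  then show ?thesis
    using n_pos unfolding of_nat_le_iff by (simp add: feasible_iff candidate_def)
qed

lemma objective_candidate: "int (objective c (candidate k)) = part k n + cf 0 * head k"
  by (simp add: objective_def part_def sum_split_0 candidate_0 candidate_nth
      flip: n_def cf_def)

text \<open>The digits are the offsets of an optimal x from the lower corner of the box; clipping
  does not affect them as x is nonnegative. Only an inequality is claimed because
  \<open>head k\<close> may exceed the first coordinate of x.\<close>

lemma optimal_le_score:
  assumes x: "optimal c R x"
  shows "\<exists>k. 0 \<le> k \<and> k < B ^ (n - 1) \<and> int (objective c x) \<le> score k"
proof -
  have normx: "(\<Sum>i<n. (x ! i)\<^sup>2) \<le> R"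
    using x by (auto simp: optimal_def is_arg_max_linorder feasible_iff n_def)
  define d where "d i = int (x ! (i + 1)) - centre (i + 1) + D" for i
  have d: "0 \<le> d i \<and> d i < B" if "i < n - 1" for i
  proof -
    have "i + 1 < n"
      using that by simp
    from optimal_in_box[OF x this] show ?thesis
      unfolding d_def B_def by linarith
  qed
  from ex_digits[OF B_pos, of "n - 1" d, OF d] obtain k where k: "0 \<le> k" "k < B ^ (n - 1)"
    "\<And>i. i < n - 1 \<Longrightarrow> k div B ^ i mod B = d i"
    by auto
  have X: "X k i = int (x ! i)" if "1 \<le> i" "i < n" for i
    using k(3)[of "i - 1"] that by (simp add: X_def d_def)
  have "int (\<Sum>i<n. (x ! i)\<^sup>2) \<le> int R"
    using normx by (simp only: of_nat_le_iff)
  then have x0: "int (x ! 0) * int (x ! 0) \<le> rem k n"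
    by (simp add: sum_split_0 X power2_eq_square rem_def)
  then have "0 \<le> rem k n"
    by (rule order_trans[rotated]) simp
  moreover from x0 have "x ! 0 \<le> floor_sqrt (nat (rem k n))"
    by (intro le_floor_sqrtI) (simp add: power2_eq_square nat_le_iff flip: of_nat_mult)
  then have "cf 0 * int (x ! 0) \<le> cf 0 * head k"
    unfolding head_def by (intro mult_left_mono) (simp_all add: cf_def)
  moreover have "int (objective c x) = cf 0 * int (x ! 0) + part k n"
    by (simp add: objective_def part_def sum_split_0 X flip: n_def cf_def)
  ultimately show ?thesis
    using k by (auto simp: score_def)
qed

text \<open>An optimal solution has a value of at least 0 and at most \<open>best\<close>, which
  excludes -1. So the recorded score is attained, its candidate is feasible, and its value reaches
  the optimum.\<close>

lemma holds_optimumI: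
  assumes k: "m 0 = score k" "m 1 = head k" "\<And>j. 1 \<le> j \<Longrightarrow> j < n \<Longrightarrow> m (1 + int j) = X k j"
    and best: "\<And>k. 0 \<le> k \<Longrightarrow> k < B ^ (n - 1) \<Longrightarrow> score k \<le> best"
    and found: "best = - 1 \<or> best = score k"
  shows "holds_optimum c R m"
proof -
  obtain x where x: "optimal c R x"
    using ex_optimal by blast
  with optimal_le_score best have obj: "int (objective c x) \<le> best"
    by (meson order_trans)
  then have "best = score k" "0 \<le> score k"
    using found by auto
  then have "0 \<le> rem k n"
    by (simp add: score_def split: if_splits)
  then have feas: "feasible n R (candidate k)" and score: "score k = int (objective c (candidate k))"
    by (simp_all add: candidate_feasible objective_candidate score_def)
  have "optimal c R (candidate k)"
    using x obj feas \<open>best = score k\<close> unfolding score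
    by (fastforce simp: optimal_def is_arg_max_linorder n_def)
  moreover have "m (int i + 1) = int (candidate k ! i)" if "i < n" for i
    using that k(2) k(3)[of i] by (cases "i = 0") (simp_all add: candidate_0 candidate_nth add.commute)
  ultimately show ?thesis
    unfolding holds_optimum_def using k(1) score by (auto simp: n_def)
qed

end

section \<open>Size of the numbers\<close>

context box_search
begin

definition L :: nat where "L = input_len c R"
text \<open>The number of boxes is at most 2^((4 + 2 L) L), which gives the quadratic term; the
  other quantities are at most 2^e * (2^L)^k with e and k up to 10.\<close>

definition bits :: nat where "bits = 2 * L\<^sup>2 + 10 * L + 10"

lemma n_less_L: "n < L"
proof -
  have "n = (\<Sum>i<length c. 1)"
    by (simp add: n_def)
  also have "\<dots> \<le> (\<Sum>i<length c. enc_len (int (c ! i)))"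
    by (intro sum_mono) (simp add: enc_len_def)
  also have "\<dots> < L"
    by (simp add: L_def input_len_def enc_len_def)
  finally show ?thesis .
qed

lemma abs_less_if_enc_len_le: "enc_len z \<le> e \<Longrightarrow> \<bar>z\<bar> < 2 ^ e"
  by (rule less_le_trans[OF abs_less_two_power_enc_len power_increasing]) simp_all

lemma R_less: "int R < 2 ^ L"
  using abs_less_if_enc_len_le[of "int R" L] by (simp add: L_def input_len_def)

lemma cf_less:
  assumes "i < n"
  shows "cf i < 2 ^ L"
proof -
  have "enc_len (int (c ! i)) \<le> (\<Sum>i<length c. enc_len (int (c ! i)))"
    using assms by (intro member_le_sum) (auto simp: n_def)
  then show ?thesis
    using abs_less_if_enc_len_le[of "int (c ! i)" L] by (simp add: L_def input_len_def cf_def)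
qed

lemma n_less: "int n < 2 ^ L"
proof -
  have "n < 2 ^ L"
    using n_less_L less_exp[of L] by linarith
  then show ?thesis
    by (metis of_nat_less_iff of_nat_numeral of_nat_power)
qed

lemma power_le_bits: "e \<le> bits \<Longrightarrow> (2::int) ^ e \<le> 2 ^ bits"
  by (rule power_increasing) simp_all

text \<open>With G = 2^L above all input numbers, every size condition except that on the number of
  boxes is compared with a monomial 2^e * G^k.\<close>

lemma bounded: "bounded_box_search c R bits"
proof -
  define G :: int where "G = 2 ^ L"
  have G: "1 \<le> G" "int R < G" "int n < G" "\<And>i. i < n \<Longrightarrow> cf i < G"
    unfolding G_def using R_less n_less cf_less by auto
  have Gpow: "2 ^ e * G ^ k \<le> 2 ^ bits" if "e \<le> 10" "k \<le> 10" for e k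
  proof -
    have "e + k * L \<le> bits"
      unfolding bits_def using that(1) mult_le_mono1[OF that(2), of L] by linarith
    from power_le_bits[OF this] show ?thesis
      by (simp only: G_def power_add mult.commute[of k L] power_mult)
  qed
  \<comment> \<open>Using G - 1 instead of G leaves room for the summand 1 in the next step, hence
    for the strict bound on 4 R n and for the 1 in D.\<close>
  have nR: "int R * int n \<le> (G - 1) * (G - 1)"
    using G by (intro mult_mono) auto
  then have nR': "4 * int R * int n + 1 \<le> 4 * G ^ 2"
    using G(1) by (simp add: power2_eq_square algebra_simps)
  have "floor_sqrt (floor_sqrt (4 * R * n)) \<le> 4 * R * n"
    using floor_sqrt_le order_trans by blast
  then have "int (floor_sqrt (floor_sqrt (4 * R * n))) \<le> int (4 * R * n)"
    by (rule of_nat_mono)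
  then have D: "D \<le> 4 * G ^ 2"
    using nR' by (simp add: D_def)
  have G2: "G \<le> G ^ 2"
    using G(1) self_le_power[of G 2] by simp
  have RD: "int R + D \<le> 5 * G ^ 2"
    using D G(2) G2 by linarith
  have B16: "B \<le> 16 * G ^ 2" "int R + B \<le> 16 * G ^ 2"
    using D G(1,2) G2 unfolding B_def by linarith+
  have sumcf: "(\<Sum>j<n. cf j) \<le> G * G"
  proof -
    have "(\<Sum>j<n. cf j) \<le> (\<Sum>j<n. G)"
      using G(4) by (intro sum_mono) (auto intro: less_imp_le)
    also have "\<dots> \<le> G * G"
      using G by (simp add: mult_right_mono)
    finally show ?thesis .
  qed
  show ?thesis
  proof unfold_locales
    show "1 \<le> bits"
      by (simp add: bits_def)
    show "int n + 1 \<le> 2 ^ bits"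
      using Gpow[of 0 1] G(3) by simp
    show "cf i \<le> 2 ^ bits" if "i < n" for i
      using Gpow[of 0 1] G(4)[OF that] by simp
    show "4 * int R * int n < 2 ^ bits"
      using Gpow[of 2 2] nR' by simp
    have "S \<le> (\<Sum>i<n. G * G)"
      unfolding S_def using G(1,4) cf_pos by (intro sum_mono mult_mono) (auto intro: less_imp_le)
    also have "\<dots> \<le> G * (G * G)"
      using G by (simp add: mult_right_mono)
    also have "\<dots> \<le> 2 ^ bits"
      using Gpow[of 0 3] by (simp add: power3_eq_cube)
    finally show "S \<le> 2 ^ bits" .
    show "int R + B \<le> 2 ^ bits"
      using Gpow[of 4 2] B16 by simp
    have "B ^ (n - 1) \<le> (16 * G ^ 2) ^ (n - 1)"
      using B16(1) B_pos by (intro power_mono) auto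
    \<comment> \<open>Since n is less than L, the exponent may be replaced by L; this is the only
      place where the bit length becomes quadratic in L.\<close>
    also have "\<dots> \<le> (16 * G ^ 2) ^ L"
      using n_less_L G(1) G2 by (intro power_increasing) linarith+
    also have "16 * G ^ 2 = 2 ^ (4 + 2 * L)"
      by (simp add: G_def power_add power_mult mult.commute[of 2 L])
    also have "(2 ^ (4 + 2 * L)) ^ L \<le> (2::int) ^ bits"
      unfolding power_mult[symmetric]
      by (rule power_le_bits) (simp add: bits_def algebra_simps power2_eq_square)
    finally show "B ^ (n - 1) \<le> 2 ^ bits" .
    have "(int R + D) * (int R + D) \<le> (5 * G ^ 2) * (5 * G ^ 2)"
      using RD D_pos by (intro mult_mono) auto
    from mult_mono[OF _ this, of "int n" G]
    have "int n * ((int R + D) * (int R + D)) \<le> G * ((5 * G ^ 2) * (5 * G ^ 2))"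
      using G(1,3) by simp
    also have "\<dots> = 25 * G ^ 5"
      by (simp add: eval_nat_numeral)
    finally have "int R + int n * ((int R + D) * (int R + D)) < 32 * G ^ 5"
      using G(1,2) self_le_power[of G 5] by simp
    also have "\<dots> \<le> 2 ^ bits"
      using Gpow[of 5 5] by simp
    finally show "int R + int n * ((int R + D) * (int R + D)) < 2 ^ bits" .
    have "(\<Sum>j<n. cf j) * (int R + D) \<le> (G * G) * (5 * G ^ 2)"
      using sumcf RD D_pos G(1) by (intro mult_mono) auto
    also have "\<dots> \<le> 8 * G ^ 4"
      using G(1) by (simp add: eval_nat_numeral)
    also have "\<dots> \<le> 2 ^ bits"
      using Gpow[of 3 4] by simp
    finally show "(\<Sum>j<n. cf j) * (int R + D) \<le> 2 ^ bits" .
  qed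
qed

lemma bnd_input: "bnd bits (input_mem c R)"
  unfolding bnd_def
proof
  fix a
  have R: "int R \<le> 2 ^ bits" and n: "int n \<le> 2 ^ bits" and c: "\<And>i. i < n \<Longrightarrow> cf i \<le> 2 ^ bits"
  proof -
    have "L \<le> bits"
      by (simp add: bits_def)
    note power_le_bits[OF this]
    then show "int R \<le> 2 ^ bits" "int n \<le> 2 ^ bits" "\<And>i. i < n \<Longrightarrow> cf i \<le> 2 ^ bits"
      using R_less n_less cf_less by (meson less_imp_le order_trans)+
  qed
  show "\<bar>input_mem c R a\<bar> \<le> 2 ^ bits"
    using R n c by (auto simp: input_mem_def Let_def nth_Cons' n_def cf_def)
qed

text \<open>Here B = 2 f + 3 with f the integer fourth root of 4 R n. The estimate f <= 3/2 u holds
  since (3/2)^4 = 81/16 exceeds 4, and doubling it makes both constants 3.\<close>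

lemma box_side_le: "real_of_int B \<le> 3 * (1 + sqrt (sqrt (real R)) * real n powr (1 / 4))"
proof -
  define f where "f = floor_sqrt (floor_sqrt (4 * R * n))"
  define u where "u = sqrt (sqrt (real R)) * real n powr (1 / 4)"
  have u0: "0 \<le> u"
    by (simp add: u_def)
  have "(real n powr (1 / 4)) ^ 4 = real n"
    using n_pos by (simp add: powr_power)
  moreover have "sqrt (sqrt (real R)) ^ 4 = ((sqrt (sqrt (real R)))\<^sup>2)\<^sup>2"
    unfolding power_mult[symmetric] by simp
  then have "sqrt (sqrt (real R)) ^ 4 = real R"
    by (simp only: real_sqrt_pow2 real_sqrt_ge_zero of_nat_0_le_iff)
  ultimately have u4: "u ^ 4 = real R * real n"
    by (simp add: u_def power_mult_distrib)
  have "f\<^sup>2 \<le> floor_sqrt (4 * R * n)"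
    by (simp add: f_def)
  then have "(f\<^sup>2)\<^sup>2 \<le> 4 * R * n"
    by (simp add: le_floor_sqrt_iff)
  then have "f ^ 4 \<le> 4 * R * n"
    by (simp flip: power_mult)
  then have "real (f ^ 4) \<le> real (4 * R * n)"
    by (simp only: of_nat_le_iff)
  then have "(real f) ^ 4 \<le> 4 * u ^ 4"
    by (simp add: u4)
  also have "\<dots> \<le> (3 / 2 * u) ^ 4"
    using u0 by (simp add: power_mult_distrib power_divide)
  finally have "real f \<le> 3 / 2 * u"
    by (rule power_mono_iff[THEN iffD1, rotated 3]) (use u0 in auto)
  then show ?thesis
    by (simp add: B_def D_def f_def[symmetric] u_def[symmetric])
qed

lemma solves:
  assumes T: "2 * (3 * (1 + sqrt (sqrt (real R)) * real n powr (1 / 4))) ^ (n - 1) *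
      (real L * (real bits + 1) * (real (prog_weight box_search_prog) * (real bits)\<^sup>2)) \<le> T"
  shows "solves_within box_search_prog c R T"
proof -
  interpret bounded_box_search c R bits
    by (rule bounded)
  have "runs bits box_search_prog (input_mem c R) ((boxes + 1) * (n * (bits + 1))) (holds_optimum c R)"
    by (rule runs_box_search[OF order_refl], rule holds_optimumI) (simp_all add: int_boxes)
  then obtain t m where t: "exec box_search_prog (input_mem c R) t m" "holds_optimum c R m"
    and time: "t \<le> (boxes + 1) * (n * (bits + 1)) * (prog_weight box_search_prog * bits\<^sup>2)"
    using bnd_input unfolding runs_def by blast
  note time
  \<comment> \<open>The extra round is absorbed by \<open>boxes + 1 \<le> 2 * boxes\<close>, and n
    by L, so that apart from the number of boxes only a polynomial in L remains.\<close>
  also have "(boxes + 1) * (n * (bits + 1)) * (prog_weight box_search_prog * bits\<^sup>2) \<le>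
      (2 * boxes) * (L * (bits + 1)) * (prog_weight box_search_prog * bits\<^sup>2)"
    using boxes_pos n_less_L by (intro mult_mono) auto
  finally have "real t \<le> real \<dots>"
    by (simp only: of_nat_le_iff)
  also have "\<dots> = 2 * real boxes *
      (real L * (real bits + 1) * (real (prog_weight box_search_prog) * (real bits)\<^sup>2))"
    by (simp add: algebra_simps)
  also have "\<dots> \<le> 2 * (3 * (1 + sqrt (sqrt (real R)) * real n powr (1 / 4))) ^ (n - 1) *
      (real L * (real bits + 1) * (real (prog_weight box_search_prog) * (real bits)\<^sup>2))"
  proof (intro mult_right_mono mult_left_mono)
    have "real boxes = real_of_int (int boxes)"
      by simp
    also have "\<dots> = real_of_int B ^ (n - 1)"
      by (simp only: int_boxes of_int_power)
    also have "\<dots> \<le> (3 * (1 + sqrt (sqrt (real R)) * real n powr (1 / 4))) ^ (n - 1)"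
      using B_pos by (intro power_mono box_side_le) simp
    finally show "real boxes \<le> \<dots>" .
  qed auto
  finally show ?thesis
    unfolding solves_within_def using t T by (meson order_trans)
qed

end

theorem theorem6p3:
  shows "\<exists>C::real. C > 0 \<and> (\<exists>(p::prog) (q::real poly). \<forall>(n::nat) (c::nat list) (R::nat) (r::real).
    n \<ge> 1 \<and> length c = n \<and> (\<forall>i<n. c ! i > 0) \<and> sorted_wrt (\<ge>) c \<and> r = sqrt (real R) \<longrightarrow>
      solves_within p c R
        ((C * (1 + sqrt r * real n powr (1 / 4))) ^ (n - 1) * poly q (real (input_len c R))))"
proof -
  \<comment> \<open>The polynomial form of \<open>bits\<close> in L. The constant C = 3 comes from
    \<open>box_side_le\<close>, and \<open>q\<close> collects the time per box.\<close>
  define \<beta> :: "real poly" where "\<beta> = [:10, 10, 2:]"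
  define q where "q = smult (2 * real (prog_weight box_search_prog)) ([:0, 1:] * (\<beta> + 1) * \<beta>\<^sup>2)"
  show ?thesis
  proof (intro exI[of _ "3::real"] conjI exI[of _ box_search_prog] exI[of _ q] allI impI; (elim conjE)?)
    fix n' R and c :: "nat list" and r :: real
    assume c: "1 \<le> n'" "length c = n'" "\<forall>i<n'. 0 < c ! i" and r: "r = sqrt (real R)"
    interpret box_search c R
      using c by unfold_locales auto
    have n: "n = n'"
      using c by (simp add: n_def)
    have \<beta>: "poly \<beta> (real L) = real bits"
      by (simp add: \<beta>_def bits_def power2_eq_square algebra_simps)
    show "solves_within box_search_prog c R
        ((3 * (1 + sqrt r * real n' powr (1 / 4))) ^ (n' - 1) * poly q (real (input_len c R)))"
      by (rule solves) (simp add: r q_def \<beta> flip: L_def n)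
  qed simp
qed

end
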